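(* Let $(\iota_n)_{n\ge0}$ be a spreadable sequence (with respect to the inner product) of isometries from a Hilbert space $\mathcal K$ into a Hilbert space $\mathcal H$, with operator angle $C$, and let $Q$ be the orthogonal projection from $\mathcal H_\infty$ onto $\mathcal H_\infty^{\alpha_0}$, where $\mathcal H_\infty$ and $\alpha_0$ belong to the corresponding minimal SCH. Then $\big((1-Q)\iota_n(\mathcal K)\big)_{n\in\mathbb N_0}$ is a sequence of pairwise orthogonal spaces. For the operator angle we have $C=\iota_1^*Q\iota_0=\iota_0^*Q\iota_0\ge0$. If the corresponding minimal SCH is saturated then $C$ is an orthogonal projection. In general all positive contractions $C:\mathcal K\to\mathcal K$ can appear as operator angles, i.e. for every Hilbert space $\mathcal K$ and every operator $0\le C\le 1$ on $\mathcal K$ there is a spreadable sequence of isometries from $\mathcal K$ into some Hilbert space with operator angle $C$.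
   Context: A sequence $(\iota_n)_{n\ge0}$ of isometries from a Hilbert space $\mathcal K$ into a Hilbert space $\mathcal H$ is called spreadable (with respect to the inner product) if there is an operator $C:\mathcal K\to\mathcal K$ (necessarily a contraction) with $\iota_j^*\iota_i=C$ for all $i<j$ (independent of $i,j$); $C$ is called the operator angle of the sequence. The corresponding minimal SCH (semi-cosimplicial Hilbert space) is given as follows: for $k\ge0$, $\mathcal H_k$ is the closed linear span of the $\iota_\ell(\mathcal K)$ with $0\le\ell\le k$; $\mathcal H_\infty$ is the closed linear span of all $\iota_\ell(\mathcal K)$, $\ell\ge0$; and for $n\in\mathbb N_0$, $\alpha_n$ is the (well-defined) isometry on $\mathcal H_\infty$ determined by $\alpha_n\iota_\ell=\iota_\ell$ for $\ell<n$ and $\alpha_n\iota_\ell=\iota_{\ell+1}$ for $\ell\ge n$. These satisfy $\alpha_j\alpha_i=\alpha_i\alpha_{j-1}$ for $0\le i<j$, $\alpha_n(\mathcal H_k)\subset\mathcal H_{k+1}$, and $\alpha_n$ fixes $\mathcal H_{n-1}$ pointwise for $n\ge1$. An augmentation $\mathcal H_{-1}$ is a closed subspace of $\mathcal H_0\cap\mathcal H_\infty^{\alpha_0}$. Here $\mathcal H_\infty^{\alpha_n}$ denotes the fixed point space of $\alpha_n$. The SCH is saturated if $\mathcal H_{n-1}=\mathcal H_\infty^{\alpha_n}$ for all $n\in\mathbb N_0$ (for $n=0$ this means that $\mathcal H_\infty^{\alpha_0}\subset\mathcal H_0$ and the augmentation is chosen to be $\mathcal H_{-1}=\mathcal H_\infty^{\alpha_0}$).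 *)

theory Defs
  imports "HOL-Analysis.Analysis"
begin

section \<open>Complex Hilbert spaces\<close>

text \<open>
  The complex inner product is linear in the second argument. Its real part is the inner product
  of the underlying real space, so norm and topology are inherited from \<^class>\<open>real_inner\<close>.
\<close>

class complex_inner = real_inner +
  fixes scaleC :: "complex \<Rightarrow> 'a \<Rightarrow> 'a"  (infixr \<open>*\<^sub>C\<close> 75)
    and cinner :: "'a \<Rightarrow> 'a \<Rightarrow> complex"
  assumes scaleC_add_right: "a *\<^sub>C (x + y) = a *\<^sub>C x + a *\<^sub>C y"
    and scaleC_add_left: "(a + b) *\<^sub>C x = a *\<^sub>C x + b *\<^sub>C x"
    and scaleC_scaleC: "a *\<^sub>C (b *\<^sub>C x) = (a * b) *\<^sub>C x"
    and scaleC_of_real: "complex_of_real r *\<^sub>C x = r *\<^sub>R x"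
    and cinner_commute: "cinner x y = cnj (cinner y x)"
    and cinner_add_right: "cinner x (y + z) = cinner x y + cinner x z"
    and cinner_scaleC_right: "cinner x (a *\<^sub>C y) = a * cinner x y"
    and Re_cinner: "Re (cinner x y) = inner x y"

class chilbert_space = complex_inner + complete_space

global_interpretation complex_vector:
  vector_space "scaleC :: complex \<Rightarrow> 'a \<Rightarrow> 'a::complex_inner"
  defines csubspace = complex_vector.subspace
proof
  fix a b :: complex and x y :: 'a
  show "1 *\<^sub>C x = x"
    using scaleC_of_real[of 1 x] by simp
qed (simp_all add: scaleC_add_right scaleC_add_left scaleC_scaleC)

definition closed_csubspace :: "'a::complex_inner set \<Rightarrow> bool" where
  "closed_csubspace M \<longleftrightarrow> csubspace M \<and> closed M"

definition closed_cspan :: "'a::complex_inner set \<Rightarrow> 'a set" where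
  "closed_cspan S = closure (complex_vector.span S)"

section \<open>Operators\<close>

definition bounded_clinear :: "('a::complex_inner \<Rightarrow> 'b::complex_inner) \<Rightarrow> bool" where
  "bounded_clinear f \<longleftrightarrow> bounded_linear f \<and> (\<forall>c x. f (c *\<^sub>C x) = c *\<^sub>C f x)"

definition cadjoint :: "('a::complex_inner \<Rightarrow> 'b::complex_inner) \<Rightarrow> 'b \<Rightarrow> 'a" where
  "cadjoint f = (SOME f'. \<forall>x y. cinner (f x) y = cinner x (f' y))"

definition cisometry_on :: "'a::complex_inner set \<Rightarrow> ('a \<Rightarrow> 'b::complex_inner) \<Rightarrow> bool" where
  "cisometry_on M f \<longleftrightarrow>
     (\<forall>x\<in>M. \<forall>y\<in>M. f (x + y) = f x + f y) \<and>
     (\<forall>c. \<forall>x\<in>M. f (c *\<^sub>C x) = c *\<^sub>C f x) \<and>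
     (\<forall>x\<in>M. norm (f x) = norm x)"

abbreviation cisometry :: "('a::complex_inner \<Rightarrow> 'b::complex_inner) \<Rightarrow> bool" where
  "cisometry \<equiv> cisometry_on UNIV"

text \<open>
  Over the complex numbers a nonnegative real quadratic form already forces self-adjointness.
\<close>

definition positive_op :: "('a::complex_inner \<Rightarrow> 'a) \<Rightarrow> bool" where
  "positive_op A \<longleftrightarrow> bounded_clinear A \<and> (\<forall>x. cinner x (A x) \<in> \<real>\<^sub>\<ge>\<^sub>0)"

definition op_le :: "('a::complex_inner \<Rightarrow> 'a) \<Rightarrow> ('a \<Rightarrow> 'a) \<Rightarrow> bool" where
  "op_le A B \<longleftrightarrow> bounded_clinear A \<and> bounded_clinear B \<and> positive_op (\<lambda>x. B x - A x)"

definition orth_proj :: "'a::complex_inner set \<Rightarrow> 'a \<Rightarrow> 'a" where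
  "orth_proj M x = (THE y. y \<in> M \<and> (\<forall>z\<in>M. cinner z (x - y) = 0))"

definition is_orth_proj :: "('a::complex_inner \<Rightarrow> 'a) \<Rightarrow> bool" where
  "is_orth_proj P \<longleftrightarrow> (\<exists>M. closed_csubspace M \<and> P = orth_proj M)"

definition orthogonal_sets :: "'a::complex_inner set \<Rightarrow> 'a set \<Rightarrow> bool" where
  "orthogonal_sets U V \<longleftrightarrow> (\<forall>u\<in>U. \<forall>v\<in>V. cinner u v = 0)"

section \<open>Spreadable sequences of isometries\<close>

definition spreadable :: "(nat \<Rightarrow> 'k::chilbert_space \<Rightarrow> 'h::chilbert_space) \<Rightarrow> bool" where
  "spreadable \<iota> \<longleftrightarrow>
     (\<forall>n. cisometry (\<iota> n)) \<and> (\<exists>C. \<forall>i j. i < j \<longrightarrow> cadjoint (\<iota> j) \<circ> \<iota> i = C)"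

definition operator_angle :: "(nat \<Rightarrow> 'k::chilbert_space \<Rightarrow> 'h::chilbert_space) \<Rightarrow> 'k \<Rightarrow> 'k" where
  "operator_angle \<iota> = (THE C. \<forall>i j. i < j \<longrightarrow> cadjoint (\<iota> j) \<circ> \<iota> i = C)"

section \<open>The minimal semi-cosimplicial Hilbert space\<close>

definition sch_space :: "(nat \<Rightarrow> 'k::chilbert_space \<Rightarrow> 'h::chilbert_space) \<Rightarrow> nat \<Rightarrow> 'h set" where
  "sch_space \<iota> k = closed_cspan (\<Union>l\<le>k. range (\<iota> l))"

definition sch_limit :: "(nat \<Rightarrow> 'k::chilbert_space \<Rightarrow> 'h::chilbert_space) \<Rightarrow> 'h set" where
  "sch_limit \<iota> = closed_cspan (\<Union>l. range (\<iota> l))"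

text \<open>
  The isometry \<open>\<alpha>\<^sub>n\<close> lives on \<^term>\<open>sch_limit \<iota>\<close> only; the extensional function space fixes its
  irrelevant values elsewhere, so that the description is unique.
\<close>

definition sch_map ::
    "(nat \<Rightarrow> 'k::chilbert_space \<Rightarrow> 'h::chilbert_space) \<Rightarrow> nat \<Rightarrow> 'h \<Rightarrow> 'h" where
  "sch_map \<iota> n = (THE a.
     a \<in> sch_limit \<iota> \<rightarrow>\<^sub>E sch_limit \<iota> \<and> cisometry_on (sch_limit \<iota>) a \<and>
     (\<forall>l x. a (\<iota> l x) = (if l < n then \<iota> l x else \<iota> (Suc l) x)))"

definition sch_fixed ::
    "(nat \<Rightarrow> 'k::chilbert_space \<Rightarrow> 'h::chilbert_space) \<Rightarrow> nat \<Rightarrow> 'h set" where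
  "sch_fixed \<iota> n = {x \<in> sch_limit \<iota>. sch_map \<iota> n x = x}"

text \<open>The set \<open>A\<close> is the augmentation, i.e. the space with index \<open>-1\<close>.\<close>

definition sch_augmentation ::
    "(nat \<Rightarrow> 'k::chilbert_space \<Rightarrow> 'h::chilbert_space) \<Rightarrow> 'h set \<Rightarrow> bool" where
  "sch_augmentation \<iota> A \<longleftrightarrow> closed_csubspace A \<and> A \<subseteq> sch_space \<iota> 0 \<inter> sch_fixed \<iota> 0"

definition sch_saturated ::
    "(nat \<Rightarrow> 'k::chilbert_space \<Rightarrow> 'h::chilbert_space) \<Rightarrow> 'h set \<Rightarrow> bool" where
  "sch_saturated \<iota> A \<longleftrightarrow>
     A = sch_fixed \<iota> 0 \<and> (\<forall>n\<ge>1. sch_space \<iota> (n - 1) = sch_fixed \<iota> n)"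

section \<open>Square-summable sequences in a Hilbert space\<close>

text \<open>
  HOL cannot quantify existentially over types, so an existence statement over all Hilbert spaces
  has to name a type. The one below has room for countably many copies of the given space.
\<close>

typedef (overloaded) 'a ell2 = "{f :: nat \<Rightarrow> 'a::complex_inner. summable (\<lambda>n. (norm (f n))\<^sup>2)}"
  morphisms ell2_nth Abs_ell2
  by (rule exI[of _ "\<lambda>_. 0"]) simp

setup_lifting type_definition_ell2

lemma summable_ell2_nth: "summable (\<lambda>n. (norm (ell2_nth f n))\<^sup>2)"
  using ell2_nth[of f] by simp

lemma ell2_eqI: "(\<And>n. ell2_nth f n = ell2_nth g n) \<Longrightarrow> f = g"
  by (simp add: ell2_nth_inject[symmetric] fun_eq_iff)

lemma summable_ell2_add:
  fixes f g :: "nat \<Rightarrow> 'a::real_normed_vector"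
  assumes "summable (\<lambda>n. (norm (f n))\<^sup>2)" "summable (\<lambda>n. (norm (g n))\<^sup>2)"
  shows "summable (\<lambda>n. (norm (f n + g n))\<^sup>2)"
proof (rule summable_comparison_test'[of "\<lambda>n. 2 * (norm (f n))\<^sup>2 + 2 * (norm (g n))\<^sup>2" 0])
  show "summable (\<lambda>n. 2 * (norm (f n))\<^sup>2 + 2 * (norm (g n))\<^sup>2)"
    by (intro summable_add summable_mult assms)
  fix n
  have "(norm (f n + g n))\<^sup>2 \<le> (norm (f n) + norm (g n))\<^sup>2"
    by (simp add: norm_triangle_ineq power_mono)
  also have "\<dots> \<le> 2 * (norm (f n))\<^sup>2 + 2 * (norm (g n))\<^sup>2"
    using sum_squares_bound[of "norm (f n)" "norm (g n)"] by (simp add: power2_sum)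
  finally show "norm ((norm (f n + g n))\<^sup>2) \<le> 2 * (norm (f n))\<^sup>2 + 2 * (norm (g n))\<^sup>2"
    by simp
qed

lemma cinner_self:
  fixes x :: "'a::complex_inner"
  shows "cinner x x = complex_of_real ((norm x)\<^sup>2)"
proof -
  have "Im (cinner x x) = 0"
    using arg_cong[OF cinner_commute[of x x], of Im] unfolding cnj.simps by linarith
  then show ?thesis
    by (simp add: complex_eq_iff Re_cinner power2_norm_eq_inner)
qed

lemma cinner_add_left: "cinner (x + y) z = cinner x z + cinner y z"
  for x y z :: "'a::complex_inner"
  by (simp add: cinner_commute[of _ z] cinner_add_right)

lemma cinner_scaleC_left: "cinner (a *\<^sub>C x) y = cnj a * cinner x y"
  for x y :: "'a::complex_inner"
  by (simp add: cinner_commute[of _ y] cinner_scaleC_right)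

lemma norm_scaleC: "norm (a *\<^sub>C x) = norm a * norm x"
  for x :: "'a::complex_inner"
proof -
  have "complex_of_real ((norm (a *\<^sub>C x))\<^sup>2) = cnj a * (a * cinner x x)"
    unfolding cinner_self[symmetric]
    by (simp add: cinner_scaleC_left cinner_scaleC_right)
  also have "\<dots> = (a * cnj a) * cinner x x"
    by (simp add: mult_ac)
  also have "\<dots> = complex_of_real ((norm a * norm x)\<^sup>2)"
    by (simp only: cinner_self complex_norm_square[symmetric] power_mult_distrib of_real_mult of_real_power)
  finally have "(norm (a *\<^sub>C x))\<^sup>2 = (norm a * norm x)\<^sup>2"
    by (simp only: of_real_eq_iff)
  then show ?thesis
    by (simp add: power2_eq_iff_nonneg)
qed

lemma norm_cinner_le: "norm (cinner x y) \<le> norm x * norm y"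
  for x y :: "'a::complex_inner"
proof (cases "cinner x y = 0")
  case False
  define u where "u = cnj (cinner x y) / norm (cinner x y)"
  have u: "norm u = 1"
    using False by (simp add: u_def norm_divide)
  have "cinner x (u *\<^sub>C y) = norm (cinner x y)"
    using False complex_norm_square[of "cinner x y"]
    by (simp add: u_def cinner_scaleC_right power2_eq_square mult.commute nonzero_divide_eq_eq)
  then have "norm (cinner x y) = inner x (u *\<^sub>C y)"
    by (simp flip: Re_cinner)
  also have "\<dots> \<le> norm x * norm (u *\<^sub>C y)"
    by (rule norm_cauchy_schwarz)
  finally show ?thesis
    by (simp add: norm_scaleC u)
qed simp

lemma summable_ell2_cinner:
  "summable (\<lambda>n. cinner (ell2_nth f n) (ell2_nth g n))"
proof (rule summable_comparison_test'[of "\<lambda>n. (norm (ell2_nth f n))\<^sup>2 + (norm (ell2_nth g n))\<^sup>2" 0])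
  show "summable (\<lambda>n. (norm (ell2_nth f n))\<^sup>2 + (norm (ell2_nth g n))\<^sup>2)"
    by (intro summable_add summable_ell2_nth)
  fix n
  have "norm (cinner (ell2_nth f n) (ell2_nth g n)) \<le> norm (ell2_nth f n) * norm (ell2_nth g n)"
    by (rule norm_cinner_le)
  also have "\<dots> \<le> (norm (ell2_nth f n))\<^sup>2 + (norm (ell2_nth g n))\<^sup>2"
    using sum_squares_bound[of "norm (ell2_nth f n)" "norm (ell2_nth g n)"]
      mult_nonneg_nonneg[OF norm_ge_zero[of "ell2_nth f n"] norm_ge_zero[of "ell2_nth g n"]]
    by linarith
  finally show "norm (cinner (ell2_nth f n) (ell2_nth g n))
      \<le> (norm (ell2_nth f n))\<^sup>2 + (norm (ell2_nth g n))\<^sup>2" .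
qed

lemma summable_ell2_inner: "summable (\<lambda>n. inner (ell2_nth f n) (ell2_nth g n))"
  using summable_Re[OF summable_ell2_cinner[of f g]] by (simp add: Re_cinner)

instantiation ell2 :: (complex_inner) real_vector
begin

lift_definition zero_ell2 :: "'a ell2" is "\<lambda>_. 0" by simp

lift_definition plus_ell2 :: "'a ell2 \<Rightarrow> 'a ell2 \<Rightarrow> 'a ell2" is "\<lambda>f g n. f n + g n"
  by (rule summable_ell2_add)

lift_definition uminus_ell2 :: "'a ell2 \<Rightarrow> 'a ell2" is "\<lambda>f n. - f n" by simp

lift_definition minus_ell2 :: "'a ell2 \<Rightarrow> 'a ell2 \<Rightarrow> 'a ell2" is "\<lambda>f g n. f n - g n"
  subgoal for f g using summable_ell2_add[of f "\<lambda>n. - g n"] by simp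
  done

lift_definition scaleR_ell2 :: "real \<Rightarrow> 'a ell2 \<Rightarrow> 'a ell2" is "\<lambda>r f n. r *\<^sub>R f n"
  by (simp add: power_mult_distrib summable_mult)

lemmas ell2_nth_simps =
  zero_ell2.rep_eq plus_ell2.rep_eq uminus_ell2.rep_eq minus_ell2.rep_eq scaleR_ell2.rep_eq

instance
proof
  fix f g h :: "'a ell2" and r s :: real
  show "f + g + h = f + (g + h)" "f + g = g + f" "0 + f = f" "- f + f = 0" "f - g = f + - g"
    "r *\<^sub>R (f + g) = r *\<^sub>R f + r *\<^sub>R g" "(r + s) *\<^sub>R f = r *\<^sub>R f + s *\<^sub>R f"
    "r *\<^sub>R s *\<^sub>R f = (r * s) *\<^sub>R f" "1 *\<^sub>R f = f"
    by (rule ell2_eqI; simp add: ell2_nth_simps algebra_simps)+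
qed

end

instantiation ell2 :: (complex_inner) complex_inner
begin

lift_definition scaleC_ell2 :: "complex \<Rightarrow> 'a ell2 \<Rightarrow> 'a ell2" is "\<lambda>c f n. c *\<^sub>C f n"
  by (simp add: norm_scaleC power_mult_distrib summable_mult)

definition cinner_ell2 :: "'a ell2 \<Rightarrow> 'a ell2 \<Rightarrow> complex" where
  "cinner_ell2 f g = (\<Sum>n. cinner (ell2_nth f n) (ell2_nth g n))"

definition inner_ell2 :: "'a ell2 \<Rightarrow> 'a ell2 \<Rightarrow> real" where
  "inner_ell2 f g = (\<Sum>n. inner (ell2_nth f n) (ell2_nth g n))"

definition norm_ell2 :: "'a ell2 \<Rightarrow> real" where
  "norm_ell2 f = sqrt (inner f f)"

definition dist_ell2 :: "'a ell2 \<Rightarrow> 'a ell2 \<Rightarrow> real" where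
  "dist_ell2 f g = norm (f - g)"

definition sgn_ell2 :: "'a ell2 \<Rightarrow> 'a ell2" where
  "sgn_ell2 f = scaleR (inverse (norm f)) f"

definition uniformity_ell2 :: "('a ell2 \<times> 'a ell2) filter" where
  "uniformity_ell2 = (INF e\<in>{0 <..}. principal {(x, y). dist x y < e})"

definition open_ell2 :: "'a ell2 set \<Rightarrow> bool" where
  "open_ell2 U \<longleftrightarrow> (\<forall>x\<in>U. \<forall>\<^sub>F (x', y) in uniformity. x' = x \<longrightarrow> y \<in> U)"

instance
proof
  fix f g h :: "'a ell2" and r s :: real and a b :: complex
  show "a *\<^sub>C (f + g) = a *\<^sub>C f + a *\<^sub>C g" "(a + b) *\<^sub>C f = a *\<^sub>C f + b *\<^sub>C f"
    "a *\<^sub>C b *\<^sub>C f = (a * b) *\<^sub>C f" "complex_of_real r *\<^sub>C f = r *\<^sub>R f"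
    by (rule ell2_eqI; simp add: ell2_nth_simps scaleC_ell2.rep_eq scaleC_add_right scaleC_add_left
          scaleC_scaleC scaleC_of_real)+
  show "dist f g = norm (f - g)" by (rule dist_ell2_def)
  show "sgn f = f /\<^sub>R norm f" by (rule sgn_ell2_def)
  show "uniformity = (INF e\<in>{0 <..}. principal {(x :: 'a ell2, y). dist x y < e})"
    by (rule uniformity_ell2_def)
  show "open U \<longleftrightarrow> (\<forall>x\<in>U. \<forall>\<^sub>F (x', y) in uniformity. x' = x \<longrightarrow> y \<in> U)" for U :: "'a ell2 set"
    by (rule open_ell2_def)
  show "inner f g = inner g f"
    by (simp add: inner_ell2_def inner_commute)
  show "inner (f + g) h = inner f h + inner g h"
    unfolding inner_ell2_def
    by (simp add: ell2_nth_simps inner_add_left suminf_add[OF summable_ell2_inner summable_ell2_inner])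
  show "inner (r *\<^sub>R f) g = r * inner f g"
    unfolding inner_ell2_def
    by (simp add: ell2_nth_simps suminf_mult[OF summable_ell2_inner])
  show "0 \<le> inner f f"
    unfolding inner_ell2_def by (rule suminf_nonneg[OF summable_ell2_inner]) simp
  show "inner f f = 0 \<longleftrightarrow> f = 0"
  proof
    assume "inner f f = 0"
    then have "ell2_nth f n = 0" for n
      unfolding inner_ell2_def using suminf_eq_zero_iff[OF summable_ell2_inner[of f f]] by simp
    then show "f = 0" by (intro ell2_eqI) (simp add: ell2_nth_simps)
  qed (simp add: inner_ell2_def ell2_nth_simps)
  show "norm f = sqrt (inner f f)" by (rule norm_ell2_def)
  show "cinner f g = cnj (cinner g f)"
  proof -
    have "cnj (cinner g f) = (\<Sum>n. cnj (cinner (ell2_nth g n) (ell2_nth f n)))"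
      unfolding cinner_ell2_def
      by (rule bounded_linear.suminf[OF bounded_linear_cnj summable_ell2_cinner])
    then show ?thesis
      by (simp add: cinner_ell2_def cinner_commute[symmetric])
  qed
  show "cinner f (g + h) = cinner f g + cinner f h"
    unfolding cinner_ell2_def
    by (simp add: ell2_nth_simps cinner_add_right suminf_add[OF summable_ell2_cinner summable_ell2_cinner])
  show "cinner f (a *\<^sub>C g) = a * cinner f g"
    unfolding cinner_ell2_def
    by (simp add: scaleC_ell2.rep_eq cinner_scaleC_right suminf_mult[OF summable_ell2_cinner])
  show "Re (cinner f g) = inner f g"
  proof -
    have "Re (cinner f g) = (\<Sum>n. Re (cinner (ell2_nth f n) (ell2_nth g n)))"
      unfolding cinner_ell2_def
      by (rule bounded_linear.suminf[OF bounded_linear_Re summable_ell2_cinner])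
    then show ?thesis
      by (simp add: inner_ell2_def Re_cinner)
  qed
qed

end

lemma norm_ell2_sq: "(norm f)\<^sup>2 = (\<Sum>n. (norm (ell2_nth f n))\<^sup>2)"
  by (simp add: power2_norm_eq_inner inner_ell2_def)

lemma sum_norm_ell2_le: "(\<Sum>n<N. (norm (ell2_nth f n))\<^sup>2) \<le> (norm f)\<^sup>2"
  unfolding norm_ell2_sq by (rule sum_le_suminf[OF summable_ell2_nth]) auto

lemma norm_ell2_nth_le: "norm (ell2_nth f n) \<le> norm f"
proof -
  have "(norm (ell2_nth f n))\<^sup>2 \<le> (\<Sum>k<Suc n. (norm (ell2_nth f k))\<^sup>2)"
    by (simp add: sum_nonneg)
  also have "\<dots> \<le> (norm f)\<^sup>2" by (rule sum_norm_ell2_le)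
  finally show ?thesis by (rule power2_le_imp_le) simp
qed

instance ell2 :: (chilbert_space) chilbert_space
proof
  fix X :: "nat \<Rightarrow> 'a ell2"
  assume X: "Cauchy X"
  have "Cauchy (\<lambda>m. ell2_nth (X m) n)" for n
  proof (rule metric_CauchyI)
    fix e :: real assume "e > 0"
    then obtain M where M: "\<forall>m\<ge>M. \<forall>k\<ge>M. dist (X m) (X k) < e"
      using metric_CauchyD[OF X] by blast
    have "dist (ell2_nth (X m) n) (ell2_nth (X k) n) \<le> dist (X m) (X k)" for m k
      using norm_ell2_nth_le[of "X m - X k" n] by (simp add: dist_norm ell2_nth_simps)
    then show "\<exists>M. \<forall>m\<ge>M. \<forall>k\<ge>M. dist (ell2_nth (X m) n) (ell2_nth (X k) n) < e"
      using M by (meson le_less_trans)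
  qed
  then have "\<forall>n. \<exists>l. (\<lambda>m. ell2_nth (X m) n) \<longlonglongrightarrow> l"
    by (simp add: Cauchy_convergent_iff convergent_def)
  then obtain g where g: "\<And>n. (\<lambda>m. ell2_nth (X m) n) \<longlonglongrightarrow> g n"
    by metis
  have *: "\<exists>M. \<forall>m\<ge>M. \<forall>N. (\<Sum>n<N. (norm (ell2_nth (X m) n - g n))\<^sup>2) \<le> e\<^sup>2" if e: "e > 0" for e
  proof -
    obtain M where M: "\<And>m k. m \<ge> M \<Longrightarrow> k \<ge> M \<Longrightarrow> dist (X m) (X k) < e"
      using metric_CauchyD[OF X e] by blast
    have "(\<Sum>n<N. (norm (ell2_nth (X m) n - g n))\<^sup>2) \<le> e\<^sup>2" if m: "m \<ge> M" for m N
    proof (rule tendsto_upperbound)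
      show "(\<lambda>k. \<Sum>n<N. (norm (ell2_nth (X m) n - ell2_nth (X k) n))\<^sup>2)
          \<longlonglongrightarrow> (\<Sum>n<N. (norm (ell2_nth (X m) n - g n))\<^sup>2)"
        by (intro tendsto_intros g)
      show "\<forall>\<^sub>F k in sequentially. (\<Sum>n<N. (norm (ell2_nth (X m) n - ell2_nth (X k) n))\<^sup>2) \<le> e\<^sup>2"
      proof (rule eventually_sequentiallyI)
        fix k assume "k \<ge> M"
        have "(\<Sum>n<N. (norm (ell2_nth (X m - X k) n))\<^sup>2) \<le> (norm (X m - X k))\<^sup>2"
          by (rule sum_norm_ell2_le)
        also have "\<dots> \<le> e\<^sup>2"
          using M[OF m \<open>k \<ge> M\<close>] by (intro power_mono) (auto simp: dist_norm)
        finally show "(\<Sum>n<N. (norm (ell2_nth (X m) n - ell2_nth (X k) n))\<^sup>2) \<le> e\<^sup>2"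
          by (simp add: ell2_nth_simps)
      qed
    qed simp
    then show ?thesis by blast
  qed
  have summ: "summable (\<lambda>n. (norm (ell2_nth (X m) n - g n))\<^sup>2)"
    and le: "(\<Sum>n. (norm (ell2_nth (X m) n - g n))\<^sup>2) \<le> e\<^sup>2"
    if "\<forall>N. (\<Sum>n<N. (norm (ell2_nth (X m) n - g n))\<^sup>2) \<le> e\<^sup>2" for m e
  proof -
    show s: "summable (\<lambda>n. (norm (ell2_nth (X m) n - g n))\<^sup>2)"
      by (rule summableI_nonneg_bounded[where x = "e\<^sup>2"]) (use that in auto)
    show "(\<Sum>n. (norm (ell2_nth (X m) n - g n))\<^sup>2) \<le> e\<^sup>2"
      by (rule suminf_le_const[OF s]) (use that in auto)
  qed
  obtain m1 where "\<forall>N. (\<Sum>n<N. (norm (ell2_nth (X m1) n - g n))\<^sup>2) \<le> 1\<^sup>2"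
    using *[of 1] by force
  from summ[OF this] have "summable (\<lambda>n. (norm (g n - ell2_nth (X m1) n))\<^sup>2)"
    by (simp add: norm_minus_commute)
  from summable_ell2_add[OF this summable_ell2_nth[of "X m1"]]
  have "summable (\<lambda>n. (norm (g n))\<^sup>2)" by simp
  then have G: "ell2_nth (Abs_ell2 g) = g"
    by (simp add: Abs_ell2_inverse)
  have "X \<longlonglongrightarrow> Abs_ell2 g"
  proof (rule metric_LIMSEQ_I)
    fix e :: real assume "e > 0"
    then obtain M where M: "\<forall>m\<ge>M. \<forall>N. (\<Sum>n<N. (norm (ell2_nth (X m) n - g n))\<^sup>2) \<le> (e/2)\<^sup>2"
      using *[of "e/2"] by auto
    have "dist (X m) (Abs_ell2 g) < e" if "m \<ge> M" for m
    proof -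
      have "(norm (X m - Abs_ell2 g))\<^sup>2 \<le> (e/2)\<^sup>2"
        using le[of m "e/2"] M that by (simp add: norm_ell2_sq ell2_nth_simps G)
      then have "norm (X m - Abs_ell2 g) \<le> e/2"
        by (rule power2_le_imp_le) (use \<open>e > 0\<close> in simp)
      then show ?thesis using \<open>e > 0\<close> by (simp add: dist_norm)
    qed
    then show "\<exists>M. \<forall>m\<ge>M. dist (X m) (Abs_ell2 g) < e" by blast
  qed
  then show "convergent X" by (rule convergentI)
qed

end

theory Submission
  imports Defs
begin

text \<open>
  The averages \<open>A\<^sub>N x = (\<iota>\<^sub>0 x + \<dots> + \<iota>\<^sub>N\<^sub>-\<^sub>1 x) / N\<close> form a Cauchy sequence, because the inner product of
  \<open>\<iota>\<^sub>i x\<close> and \<open>\<iota>\<^sub>j x\<close> takes only two values, one for \<open>i = j\<close> and one for \<open>i \<noteq> j\<close>. Their limit is fixed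
  by \<open>\<alpha>\<^sub>0\<close>, which shifts the sequence, and differs from every \<open>\<iota>\<^sub>n x\<close> by a vector orthogonal to the fixed
  space; hence it equals \<open>Q \<iota>\<^sub>n x\<close> for all \<open>n\<close>. Pairing limits of averages gives
  \<open>\<langle>Q \<iota>\<^sub>m y, Q \<iota>\<^sub>n x\<rangle> = \<langle>C y, x\<rangle>\<close>, which contains positivity and the orthogonality relations.

  Conversely, for \<open>0 \<le> C \<le> 1\<close> put \<open>C\<^sub>0 = C\<close> and \<open>C\<^sub>k\<^sub>+\<^sub>1 = C\<^sub>k - C\<^sub>k\<^sup>2\<close>. All \<open>C\<^sub>k\<close> are positive contractions and
  \<open>C\<^sub>k x\<close> tends to zero, so \<open>C\<close> is the sum of the \<open>C\<^sub>k\<^sup>2\<close>. The map \<open>T x = (C\<^sub>k x)\<^sub>k\<close> thus satisfies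
  \<open>T\<^sup>* T = C\<close>. With \<open>S\<close> built in the same way from \<open>1 - C\<close>, the isometry \<open>\<iota>\<^sub>n\<close> places \<open>T x\<close> in a common
  block of coordinates and \<open>S x\<close> in a block of its own.
\<close>

section \<open>Complex inner products\<close>

lemma cinner_minus_right: "cinner x (- y) = - cinner x y"
  for x y :: "'a::complex_inner"
  using cinner_add_right[of x y "- y"] cinner_add_right[of x 0 0]
  by (simp add: eq_neg_iff_add_eq_0 add.commute)

lemma cinner_diff_right: "cinner x (y - z) = cinner x y - cinner x z"
  for x y z :: "'a::complex_inner"
  using cinner_add_right[of x y "- z"] by (simp add: cinner_minus_right)

lemma cinner_diff_left: "cinner (x - y) z = cinner x z - cinner y z"
  for x y z :: "'a::complex_inner"
  by (simp add: cinner_commute[of _ z] cinner_diff_right)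

lemma cinner_scaleR_right: "cinner x (r *\<^sub>R y) = r *\<^sub>R cinner x y"
  for x y :: "'a::complex_inner"
  by (metis cinner_scaleC_right scaleC_of_real scaleR_conv_of_real)

lemma bounded_linear_cinner_right: "bounded_linear (cinner x)"
  for x :: "'a::complex_inner"
  by (rule bounded_linear_intro[of _ "norm x"])
    (simp_all add: cinner_add_right cinner_scaleR_right norm_cinner_le
      mult.commute[of "norm _" "norm x"])

lemma cinner_zero_right: "cinner x 0 = 0"
  for x :: "'a::complex_inner"
  using linear_simps(3)[OF bounded_linear_cinner_right] .

lemma tendsto_cinner:
  fixes f g :: "_ \<Rightarrow> 'a::complex_inner"
  assumes f: "(f \<longlongrightarrow> a) F" and g: "(g \<longlongrightarrow> b) F"
  shows "((\<lambda>n. cinner (f n) (g n)) \<longlongrightarrow> cinner a b) F"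
proof -
  interpret bounded_bilinear "cinner :: 'a \<Rightarrow> 'a \<Rightarrow> complex"
  proof
    show "cinner (r *\<^sub>R x) y = r *\<^sub>R cinner x y" for r and x y :: 'a
      by (simp add: cinner_commute[of _ y] cinner_scaleR_right)
    show "\<exists>K. \<forall>(x::'a) y. norm (cinner x y) \<le> norm x * norm y * K"
      by (intro exI[of _ 1]) (simp add: norm_cinner_le)
  qed (simp_all add: cinner_add_left cinner_add_right cinner_scaleR_right)
  show ?thesis using f g by (rule tendsto)
qed

lemma cinner_eq_0_iff: "cinner x x = 0 \<longleftrightarrow> x = 0"
  for x :: "'a::complex_inner"
  by (simp add: cinner_self)

lemma cinner_ext:
  fixes x y :: "'a::complex_inner"
  assumes "\<And>z. cinner z x = cinner z y"
  shows "x = y"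
  using assms[of "x - y"] cinner_eq_0_iff[of "x - y"] by (simp add: cinner_diff_right)

text \<open>The form is conjugate-linear on the left, so multiplying \<open>x\<close> by
  \<open>\<i>\<close> moves the imaginary part into the real part. Complex identities thereby reduce
  to pairs of real ones.\<close>

lemma Im_cinner: "Im (cinner x y) = inner (\<i> *\<^sub>C x) y"
  for x y :: "'a::complex_inner"
  by (simp add: Re_cinner[symmetric] cinner_scaleC_left)

lemma csubspace_imp_subspace: "csubspace M \<Longrightarrow> subspace M"
  for M :: "'a::complex_inner set"
  unfolding subspace_def complex_vector.subspace_def by (metis scaleC_of_real)

lemma bounded_linear_scaleC: "bounded_linear ((*\<^sub>C) c :: 'a \<Rightarrow> 'a::complex_inner)"
proof (rule bounded_linear_intro[of _ "norm c"])
  show "c *\<^sub>C r *\<^sub>R x = r *\<^sub>R c *\<^sub>C x" for r and x :: 'a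
    by (simp add: scaleC_of_real[symmetric] scaleC_scaleC mult.commute)
qed (simp_all add: scaleC_add_right norm_scaleC mult.commute)

section \<open>Projections and adjoints of isometries\<close>

text \<open>A minimizing sequence is Cauchy by the parallelogram law: midpoints stay in
  \<open>M\<close>, so they are no closer to \<open>x\<close> than the infimum
  \<open>d\<close>.\<close>

lemma minimal_distance_attained:
  fixes M :: "'a::real_inner set"
  assumes M: "complete M" "subspace M"
  obtains m where "m \<in> M" "\<And>z. z \<in> M \<Longrightarrow> norm (x - m) \<le> norm (x - z)"
proof -
  define d where "d = infdist x M"
  have ne: "M \<noteq> {}" using subspace_0[OF M(2)] by auto
  have d: "d \<ge> 0" "\<And>z. z \<in> M \<Longrightarrow> d \<le> norm (x - z)"
    using infdist_nonneg infdist_le[of _ M x] by (auto simp: d_def dist_norm)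
  have "\<exists>m\<in>M. norm (x - m) < d + 1 / real (Suc n)" for n
    unfolding dist_norm[symmetric]
    using cINF_less_iff[of M "dist x" "d + 1 / real (Suc n)"] ne
    by (auto simp: d_def infdist_notempty)
  then obtain m where m: "\<And>n. m n \<in> M" "\<And>n. norm (x - m n) < d + 1 / real (Suc n)"
    by metis
  have lim0: "(\<lambda>n. 1 / real (Suc n)) \<longlonglongrightarrow> 0"
    using LIMSEQ_inverse_real_of_nat by (simp add: inverse_eq_divide)
  have nlim: "(\<lambda>n. norm (x - m n)) \<longlonglongrightarrow> d"
  proof (rule tendsto_sandwich[of "\<lambda>_. d" _ _ "\<lambda>n. d + 1 / real (Suc n)"])
    show "(\<lambda>n. d + 1 / real (Suc n)) \<longlonglongrightarrow> d"
      using tendsto_add[OF tendsto_const lim0] by simp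
    show "\<forall>\<^sub>F n in sequentially. d \<le> norm (x - m n)"
      by (simp add: d(2) m(1))
    show "\<forall>\<^sub>F n in sequentially. norm (x - m n) \<le> d + 1 / real (Suc n)"
      by (intro always_eventually allI less_imp_le m)
  qed simp
  have par: "(norm (m i - m j))\<^sup>2 \<le> 2 * (norm (x - m i))\<^sup>2 + 2 * (norm (x - m j))\<^sup>2 - 4 * d\<^sup>2"
    for i j
  proof -
    have "(1/2) *\<^sub>R (m i + m j) \<in> M"
      using M(2) m(1) by (simp add: subspace_add subspace_scale)
    then have "d\<^sup>2 \<le> (norm (x - (1/2) *\<^sub>R (m i + m j)))\<^sup>2"
      using d by (intro power_mono) auto
    moreover have "4 * (norm (x - (1/2) *\<^sub>R (m i + m j)))\<^sup>2 + (norm (m i - m j))\<^sup>2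
        = 2 * (norm (x - m i))\<^sup>2 + 2 * (norm (x - m j))\<^sup>2"
      unfolding power2_norm_eq_inner by (simp add: inner_simps inner_commute algebra_simps)
    ultimately show ?thesis by linarith
  qed
  have "Cauchy m"
  proof (rule metric_CauchyI)
    fix e :: real assume e: "e > 0"
    have "(\<lambda>n. (norm (x - m n))\<^sup>2 - d\<^sup>2) \<longlonglongrightarrow> d\<^sup>2 - d\<^sup>2"
      by (intro tendsto_intros nlim)
    then have "eventually (\<lambda>n. (norm (x - m n))\<^sup>2 - d\<^sup>2 < e\<^sup>2 / 4) sequentially"
      using e by (intro order_tendstoD(2)) auto
    then obtain N where N: "\<And>n. n \<ge> N \<Longrightarrow> (norm (x - m n))\<^sup>2 - d\<^sup>2 < e\<^sup>2 / 4"
      by (auto simp: eventually_sequentially)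
    have "dist (m i) (m j) < e" if "i \<ge> N" "j \<ge> N" for i j
    proof -
      have "(norm (m i - m j))\<^sup>2 < e\<^sup>2"
        using par[of i j] N[OF that(1)] N[OF that(2)] by linarith
      then show ?thesis
        using e by (simp add: dist_norm power2_less_imp_less)
    qed
    then show "\<exists>N. \<forall>i\<ge>N. \<forall>j\<ge>N. dist (m i) (m j) < e" by blast
  qed
  then obtain l where l: "l \<in> M" "m \<longlonglongrightarrow> l"
    using M(1) m(1) unfolding complete_def by blast
  have "(\<lambda>n. norm (x - m n)) \<longlonglongrightarrow> norm (x - l)"
    by (intro tendsto_intros l)
  then have "norm (x - l) = d" using nlim LIMSEQ_unique by blast
  with l d that show ?thesis by auto
qed

lemma projection_exists:
  fixes M :: "'a::complex_inner set"
  assumes M: "complete M" "csubspace M"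
  obtains m where "m \<in> M" "\<And>z. z \<in> M \<Longrightarrow> cinner z (x - m) = 0"
proof -
  have sM: "subspace M" using M(2) by (rule csubspace_imp_subspace)
  obtain m where m: "m \<in> M" "\<And>z. z \<in> M \<Longrightarrow> norm (x - m) \<le> norm (x - z)"
    using minimal_distance_attained[OF M(1) sM, of x] by blast
  have orth: "inner z (x - m) = 0" if z: "z \<in> M" for z
  proof (cases "z = 0")
    case False
    \<comment> \<open>The minimizer of the quadratic polynomial that sends \<open>t\<close> to the
      squared norm of \<open>x - (m + t *\<^sub>R z)\<close>; its gain over \<open>t = 0\<close>
      must vanish because \<open>m\<close> is already optimal.\<close>
    define t where "t = inner z (x - m) / (norm z)\<^sup>2"
    have "m + t *\<^sub>R z \<in> M"
      using sM m(1) z by (simp add: subspace_add subspace_scale)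
    then have "(norm (x - m))\<^sup>2 \<le> (norm (x - (m + t *\<^sub>R z)))\<^sup>2"
      using m(2) by (intro power_mono) auto
    also have "\<dots> = (norm (x - m))\<^sup>2 - 2 * t * inner z (x - m) + t\<^sup>2 * (norm z)\<^sup>2"
      unfolding power2_norm_eq_inner
      by (simp add: inner_simps inner_commute algebra_simps power2_eq_square)
    also have "\<dots> = (norm (x - m))\<^sup>2 - (inner z (x - m))\<^sup>2 / (norm z)\<^sup>2"
      using False by (simp add: t_def field_simps power2_eq_square)
    finally have "(inner z (x - m))\<^sup>2 / (norm z)\<^sup>2 \<le> 0" by simp
    then show ?thesis
      using False by (simp add: divide_le_0_iff)
  qed simp
  have "cinner z (x - m) = 0" if z: "z \<in> M" for z
  proof -
    \<comment> \<open>Real orthogonality to both \<open>z\<close> and its multiple by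
      \<open>\<i>\<close> amounts to complex orthogonality to \<open>z\<close>.\<close>
    have "\<i> *\<^sub>C z \<in> M" using M(2) z by (simp add: complex_vector.subspace_scale)
    then show ?thesis
      using orth[OF z] orth[of "\<i> *\<^sub>C z"] by (simp add: complex_eq_iff Re_cinner Im_cinner)
  qed
  with m(1) that show ?thesis by blast
qed

text \<open>Two candidates differ by a vector of \<open>M\<close> that is orthogonal to
  \<open>M\<close>, hence to itself; this makes the definite description in \<open>orth_proj\<close>
  meaningful.\<close>

lemma orth_proj_eqI:
  fixes M :: "'a::complex_inner set"
  assumes M: "csubspace M" and y: "y \<in> M" "\<And>z. z \<in> M \<Longrightarrow> cinner z (x - y) = 0"
  shows "orth_proj M x = y"
  unfolding orth_proj_def
proof (rule the_equality)
  fix w assume w: "w \<in> M \<and> (\<forall>z\<in>M. cinner z (x - w) = 0)"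
  have "w - y \<in> M" using M w y by (simp add: complex_vector.subspace_diff)
  then have "cinner (w - y) ((x - y) - (x - w)) = 0"
    using w y by (simp add: cinner_diff_right)
  then show "w = y" by (simp add: cinner_eq_0_iff)
qed (use y in auto)

lemma cisometry_on_diff:
  assumes "csubspace M" "cisometry_on M f" "x \<in> M" "y \<in> M"
  shows "f (x - y) = f x - f y"
proof -
  have "f ((x - y) + y) = f (x - y) + f y"
    using assms complex_vector.subspace_diff[OF assms(1,3,4)] unfolding cisometry_on_def by blast
  then show ?thesis by simp
qed

lemma cisometry_on_norm_diff:
  assumes "csubspace M" "cisometry_on M f" "x \<in> M" "y \<in> M"
  shows "norm (f x - f y) = norm (x - y)"
  using cisometry_on_diff[OF assms] assms complex_vector.subspace_diff[OF assms(1,3,4)]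
  unfolding cisometry_on_def by metis

text \<open>Polarization recovers the real part from norms, and the real part at
  \<open>\<i> *\<^sub>C x\<close> recovers the imaginary part.\<close>

lemma cisometry_on_cinner:
  assumes M: "csubspace M" and f: "cisometry_on M f" and xy: "x \<in> M" "y \<in> M"
  shows "cinner (f x) (f y) = cinner x y"
proof -
  have inner: "inner (f x) (f y) = inner x y" if "x \<in> M" "y \<in> M" for x y
    using f that complex_vector.subspace_add[OF M that]
    unfolding dot_norm cisometry_on_def by (metis (no_types))
  have "\<i> *\<^sub>C x \<in> M" using M xy by (simp add: complex_vector.subspace_scale)
  moreover have "f (\<i> *\<^sub>C x) = \<i> *\<^sub>C f x" using f xy unfolding cisometry_on_def by blast
  ultimately show ?thesis
    using inner[OF xy] inner[of "\<i> *\<^sub>C x" y] xy by (simp add: complex_eq_iff Re_cinner Im_cinner)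
qed

lemma cisometry_cinner:
  assumes "cisometry f"
  shows "cinner (f x) (f y) = cinner x y"
  by (rule cisometry_on_cinner[OF complex_vector.subspace_UNIV assms]) auto

lemma bounded_linear_cisometry:
  assumes f: "cisometry f"
  shows "bounded_linear f"
proof (rule bounded_linear_intro[of _ 1])
  show "f (r *\<^sub>R x) = r *\<^sub>R f x" for r x
    using f unfolding cisometry_on_def by (metis UNIV_I scaleC_of_real)
qed (use f in \<open>auto simp: cisometry_on_def\<close>)

lemma csubspace_range_cisometry:
  assumes f: "cisometry f"
  shows "csubspace (range f)"
proof (rule complex_vector.subspaceI)
  show "0 \<in> range f"
    using linear_simps(3)[OF bounded_linear_cisometry[OF f]] by (metis rangeI)
  have f: "f (a + b) = f a + f b" "f (c *\<^sub>C a) = c *\<^sub>C f a" for a b c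
    using f by (simp_all add: cisometry_on_def)
  show "x + y \<in> range f" if "x \<in> range f" "y \<in> range f" for x y
    using that by (auto simp: f[symmetric])
  show "c *\<^sub>C x \<in> range f" if "x \<in> range f" for c x
    using that by (auto simp: f[symmetric])
qed

lemma complete_range_cisometry:
  fixes f :: "'a::chilbert_space \<Rightarrow> 'b::complex_inner"
  assumes f: "cisometry f"
  shows "complete (range f)"
  by (rule complete_isometric_image[of 1])
    (use f bounded_linear_cisometry[OF f] in \<open>auto simp: cisometry_on_def complete_UNIV\<close>)

text \<open>The choice in \<open>cadjoint\<close> has a witness: project \<open>y\<close> onto the
  range of \<open>f\<close>, which is complete, and take the preimage of the projection.\<close>

lemma cadjoint_cisometry:
  fixes f :: "'a::chilbert_space \<Rightarrow> 'b::complex_inner"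
  assumes f: "cisometry f"
  shows "cinner (f x) y = cinner x (cadjoint f y)"
proof -
  have "\<exists>u. \<forall>x. cinner (f x) y = cinner x u" for y
  proof -
    obtain m where m: "m \<in> range f" "\<And>z. z \<in> range f \<Longrightarrow> cinner z (y - m) = 0"
      using projection_exists[OF complete_range_cisometry csubspace_range_cisometry, OF f f]
      by blast
    then obtain u where u: "m = f u" by auto
    have "cinner (f x) y = cinner x u" for x
      using m(2)[of "f x"] by (simp add: u cinner_diff_right cisometry_cinner[OF f])
    then show ?thesis by blast
  qed
  then have "\<exists>f'. \<forall>x y. cinner (f x) y = cinner x (f' y)" by metis
  then show ?thesis
    unfolding cadjoint_def by (rule someI2_ex) auto
qed

lemma cadjoint_cisometry_eqI:
  fixes f :: "'a::chilbert_space \<Rightarrow> 'b::complex_inner"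
  assumes "cisometry f" "\<And>x. cinner (f x) y = cinner x u"
  shows "cadjoint f y = u"
  using assms cadjoint_cisometry[OF assms(1)] by (intro cinner_ext) metis

section \<open>Isometries determined by Gram matrices\<close>

lemma csubspace_closure:
  fixes M :: "'a::complex_inner set"
  assumes M: "csubspace M"
  shows "csubspace (closure M)"
proof (rule complex_vector.subspaceI)
  show "0 \<in> closure M"
    using complex_vector.subspace_0[OF M] closure_subset by auto
  show "x + y \<in> closure M" if "x \<in> closure M" "y \<in> closure M" for x y
    using that M unfolding closure_sequential
    by (metis (no_types, lifting) complex_vector.subspace_add tendsto_add)
  show "c *\<^sub>C x \<in> closure M" if "x \<in> closure M" for c x
    using that M unfolding closure_sequential
    by (metis (no_types, lifting) complex_vector.subspace_scale
        bounded_linear.tendsto[OF bounded_linear_scaleC])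
qed

lemma subspace_closure:
  fixes M :: "'a::real_normed_vector set"
  assumes M: "subspace M"
  shows "subspace (closure M)"
proof (rule subspaceI)
  show "0 \<in> closure M"
    using subspace_0[OF M] closure_subset by auto
  show "x + y \<in> closure M" if "x \<in> closure M" "y \<in> closure M" for x y
    using that M unfolding closure_sequential
    by (metis (no_types, lifting) subspace_add tendsto_add)
  show "c *\<^sub>R x \<in> closure M" if "x \<in> closure M" for c x
    using that M unfolding closure_sequential
    by (metis (no_types, lifting) subspace_scale tendsto_scaleR tendsto_const)
qed

lemma closed_csubspace_closed_cspan: "closed_csubspace (closed_cspan S)"
  unfolding closed_csubspace_def closed_cspan_def
  by (simp add: csubspace_closure complex_vector.subspace_span)

lemma closed_cspan_superset: "S \<subseteq> closed_cspan S"
  unfolding closed_cspan_def using complex_vector.span_superset closure_subset by blast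

lemma closed_cspan_minimal:
  "S \<subseteq> M \<Longrightarrow> closed_csubspace M \<Longrightarrow> closed_cspan S \<subseteq> M"
  unfolding closed_cspan_def closed_csubspace_def
  by (simp add: closure_minimal complex_vector.span_minimal)

text \<open>Isometries that agree on generators therefore agree on the closed span. With the
  identity as \<open>g\<close>, fixed spaces are closed subspaces.\<close>

lemma closed_csubspace_equalizer:
  fixes M :: "'a::complex_inner set"
  assumes M: "closed_csubspace M" and f: "cisometry_on M f" and g: "cisometry_on M g"
  shows "closed_csubspace {x \<in> M. f x = g x}"
proof -
  have sM: "csubspace M" and cM: "closed M" using M by (auto simp: closed_csubspace_def)
  have "csubspace {x \<in> M. f x = g x}"
  proof (rule complex_vector.subspaceI)
    have "f 0 = 0" "g 0 = 0"
      using f g complex_vector.subspace_0[OF sM] unfolding cisometry_on_def by auto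
    then show "0 \<in> {x \<in> M. f x = g x}"
      using complex_vector.subspace_0[OF sM] by simp
  qed (use sM f g in \<open>auto simp: cisometry_on_def complex_vector.subspace_add complex_vector.subspace_scale\<close>)
  moreover have "closed {x \<in> M. f x = g x}"
    unfolding closed_sequential_limits
  proof (intro allI impI, elim conjE)
    fix X l assume X: "\<forall>n. X n \<in> {x \<in> M. f x = g x}" and l: "X \<longlonglongrightarrow> l"
    have lM: "l \<in> M" using cM X l unfolding closed_sequential_limits by blast
    have *: "(\<lambda>n. h (X n)) \<longlonglongrightarrow> h l" if "cisometry_on M h" for h :: "'a \<Rightarrow> 'b"
    proof -
      have "norm (h (X n) - h l) = norm (X n - l)" for n
        using cisometry_on_norm_diff[OF sM that] X lM by auto
      then show ?thesis using l by (simp add: tendsto_iff dist_norm)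
    qed
    have "(\<lambda>n. f (X n)) = (\<lambda>n. g (X n))" using X by auto
    then have "f l = g l" using *[OF f] *[OF g] LIMSEQ_unique by metis
    then show "l \<in> {x \<in> M. f x = g x}" using lM by simp
  qed
  ultimately show ?thesis by (simp add: closed_csubspace_def)
qed

text \<open>The graph of the isometry is the closed real span of the pairs \<open>(c u\<^sub>i, c v\<^sub>i)\<close>: equality of
  the Gram matrices says that both coordinates of its elements have the same norm.\<close>

lemma gram_isometry:
  fixes u :: "'i \<Rightarrow> 'a::chilbert_space" and v :: "'i \<Rightarrow> 'b::chilbert_space"
  assumes gram: "\<And>i j. cinner (u i) (u j) = cinner (v i) (v j)"
  obtains T where "T \<in> closed_cspan (range u) \<rightarrow> closed_cspan (range v)"
    "cisometry_on (closed_cspan (range u)) T" "\<And>i. T (u i) = v i"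
proof -
  \<comment> \<open>All complex multiples of the generating pairs are included, so that the real
    span, taken in a product with only its real structure, is stable under complex scaling.\<close>
  define R where "R = (\<lambda>(c, i). (c *\<^sub>C u i, c *\<^sub>C v i)) ` UNIV"
  define G where "G = closure (span R)"
  have R: "(c *\<^sub>C u i, c *\<^sub>C v i) \<in> R" for c i
    unfolding R_def by force
  have RG: "(c *\<^sub>C u i, c *\<^sub>C v i) \<in> G" for c i
    unfolding G_def by (intro subsetD[OF closure_subset] span_base R)
  have uvG: "(u i, v i) \<in> G" for i
    using RG[of 1 i] by simp
  have sG: "subspace G"
    unfolding G_def by (simp add: subspace_closure subspace_span)
  have G_minimal: "G \<subseteq> A" if "R \<subseteq> A" "subspace A" "closed A" for A
    unfolding G_def using that by (simp add: span_minimal closure_minimal)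
  have innR: "inner (fst p) (fst q) = inner (snd p) (snd q)" if "p \<in> R" "q \<in> R" for p q
    using that by (auto simp: R_def Re_cinner[symmetric] cinner_scaleC_left cinner_scaleC_right gram)
  have innRS: "inner (fst p) (fst q) = inner (snd p) (snd q)" if "p \<in> R" "q \<in> span R" for p q
    using that(2) by (induction rule: span_induct_alt) (auto simp: inner_simps innR[OF that(1)])
  have innS: "inner (fst p) (fst q) = inner (snd p) (snd q)" if "p \<in> span R" "q \<in> span R" for p q
    using that(1)
    by (induction rule: span_induct_alt) (auto simp: inner_simps innRS[OF _ that(2)])
  have "norm (fst p) = norm (snd p)" if "p \<in> span R" for p
    using innS[OF that that] by (simp add: norm_eq_sqrt_inner)
  then have "span R \<subseteq> {p. norm (fst p) = norm (snd p)}" by blast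
  moreover have "closed {p :: 'a \<times> 'b. norm (fst p) = norm (snd p)}"
    by (intro closed_Collect_eq continuous_intros)
  ultimately have "G \<subseteq> {p. norm (fst p) = norm (snd p)}"
    unfolding G_def by (rule closure_minimal)
  then have nG: "norm (fst p) = norm (snd p)" if "p \<in> G" for p
    using that by auto
  have uniq: "b = b'" if "(a, b) \<in> G" "(a, b') \<in> G" for a b b'
    using nG[OF subspace_diff[OF sG that]] by simp
  have scaleG: "(c *\<^sub>C a, c *\<^sub>C b) \<in> G" if "(a, b) \<in> G" for a b c
  proof -
    have bl: "bounded_linear (\<lambda>p. (c *\<^sub>C fst p, c *\<^sub>C snd p))"
      by (intro bounded_linear_Pair bounded_linear_compose[OF bounded_linear_scaleC]
          bounded_linear_fst bounded_linear_snd)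
    have "R \<subseteq> (\<lambda>p. (c *\<^sub>C fst p, c *\<^sub>C snd p)) -` G"
      by (auto simp: R_def scaleC_scaleC RG)
    moreover have "closed ((\<lambda>p. (c *\<^sub>C fst p, c *\<^sub>C snd p)) -` G)"
      using bl by (intro closed_vimage) (auto simp: G_def intro: linear_continuous_on)
    moreover have "subspace ((\<lambda>p. (c *\<^sub>C fst p, c *\<^sub>C snd p)) -` G)"
      using bounded_linear.linear[OF bl] sG by (intro linear_subspace_vimage)
    ultimately have "G \<subseteq> (\<lambda>p. (c *\<^sub>C fst p, c *\<^sub>C snd p)) -` G"
      by (intro G_minimal)
    from subsetD[OF this that] show ?thesis by simp
  qed
  have "closed_csubspace (fst ` G)"
    unfolding closed_csubspace_def
  proof
    show "csubspace (fst ` G)"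
    proof (rule complex_vector.subspaceI)
      show "0 \<in> fst ` G" using subspace_0[OF sG] by force
      show "x + y \<in> fst ` G" if "x \<in> fst ` G" "y \<in> fst ` G" for x y
        using that subspace_add[OF sG] by (metis (no_types, lifting) fst_add imageE imageI)
      show "c *\<^sub>C x \<in> fst ` G" if "x \<in> fst ` G" for c x
        using that scaleG by force
    qed
    \<comment> \<open>On \<open>G\<close> both coordinates have equal norm, so \<open>fst\<close> is
      bounded below by the factor 1/2 and maps the complete set \<open>G\<close> onto a complete
      set.\<close>
    have "norm p \<le> norm (fst p) + norm (snd p)" for p :: "'a \<times> 'b"
      using norm_Pair_le[of "fst p" "snd p"] by simp
    then have "\<forall>p\<in>G. norm (fst p) \<ge> 1/2 * norm p"
      using nG by (smt (verit, best) field_sum_of_halves mult_cancel_right1 times_divide_eq_left)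
    then have "complete (fst ` G)"
      by (intro complete_isometric_image[of "1/2"] sG bounded_linear_fst)
        (auto simp: complete_eq_closed G_def)
    then show "closed (fst ` G)" by (rule complete_imp_closed)
  qed
  moreover have "range u \<subseteq> fst ` G"
    using uvG by force
  ultimately have dom: "closed_cspan (range u) \<subseteq> fst ` G"
    by (intro closed_cspan_minimal)
  have "G \<subseteq> snd -` closed_cspan (range v)"
  proof (rule G_minimal)
    have V: "csubspace (closed_cspan (range v))" "closed (closed_cspan (range v))"
      using closed_csubspace_closed_cspan[of "range v"] by (auto simp: closed_csubspace_def)
    show "R \<subseteq> snd -` closed_cspan (range v)"
      using subsetD[OF closed_cspan_superset, of _ "range v"] complex_vector.subspace_scale[OF V(1)]
      by (auto simp: R_def)
    show "subspace (snd -` closed_cspan (range v))"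
      by (intro linear_subspace_vimage csubspace_imp_subspace V) (simp add: linear_snd)
    show "closed (snd -` closed_cspan (range v))"
      by (intro closed_vimage V continuous_intros)
  qed
  then have cod: "b \<in> closed_cspan (range v)" if "(a, b) \<in> G" for a b
    using that by auto
  define T where "T = (\<lambda>a. SOME b. (a, b) \<in> G)"
  have T: "(a, T a) \<in> G" if "a \<in> closed_cspan (range u)" for a
    unfolding T_def using subsetD[OF dom that] by (intro someI_ex[of "\<lambda>b. (a, b) \<in> G"]) force
  have TI: "T a = b" if "(a, b) \<in> G" for a b
    unfolding T_def using that uniq by blast
  show ?thesis
  proof (rule that[of T])
    show "T \<in> closed_cspan (range u) \<rightarrow> closed_cspan (range v)"
      using T cod by blast
    show "T (u i) = v i" for i
      by (intro TI uvG)
    show "cisometry_on (closed_cspan (range u)) T"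
      unfolding cisometry_on_def
    proof (intro conjI ballI allI)
      fix x y c assume x: "x \<in> closed_cspan (range u)"
      show "T (c *\<^sub>C x) = c *\<^sub>C T x" by (intro TI scaleG T x)
      show "norm (T x) = norm x" using nG[OF T[OF x]] by simp
      assume y: "y \<in> closed_cspan (range u)"
      show "T (x + y) = T x + T y"
        using subspace_add[OF sG T[OF x] T[OF y]] by (intro TI) simp
    qed
  qed
qed

section \<open>Spreadable sequences\<close>

text \<open>The terms before \<open>K\<close> contribute a fixed vector \<open>S\<close>, which is
  divided by \<open>N\<close> and disappears in the limit.\<close>

lemma tendsto_average_eventually_const:
  fixes f :: "nat \<Rightarrow> 'a::real_normed_vector"
  assumes f: "\<And>k. k \<ge> K \<Longrightarrow> f k = c"
  shows "(\<lambda>N. (\<Sum>k<N. f k) /\<^sub>R real N) \<longlonglongrightarrow> c"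
proof -
  define S where "S = (\<Sum>k<K. f k - c)"
  have "(\<lambda>N. c + inverse (real N) *\<^sub>R S) \<longlonglongrightarrow> c + 0 *\<^sub>R S"
    by (intro tendsto_intros lim_inverse_n)
  moreover have "\<forall>\<^sub>F N in sequentially. c + inverse (real N) *\<^sub>R S = (\<Sum>k<N. f k) /\<^sub>R real N"
  proof (rule eventually_sequentiallyI[of "Suc K"])
    fix N assume N: "N \<ge> Suc K"
    have "(\<Sum>k<N. f k - c) = S"
      unfolding S_def using N f by (intro sum.mono_neutral_right) auto
    then have "(\<Sum>k<N. f k) = real N *\<^sub>R c + S"
      by (simp add: sum_subtractf scaleR_conv_of_real sum_constant_scaleR algebra_simps)
    then show "c + inverse (real N) *\<^sub>R S = (\<Sum>k<N. f k) /\<^sub>R real N"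
      using N by (simp add: scaleR_add_right)
  qed
  ultimately show ?thesis
    using tendsto_cong by fastforce
qed

locale spreadable_sequence =
  fixes \<iota> :: "nat \<Rightarrow> 'k::chilbert_space \<Rightarrow> 'h::chilbert_space"
  assumes spreadable: "spreadable \<iota>"
begin

abbreviation "C \<equiv> operator_angle \<iota>"

lemma isometry: "cisometry (\<iota> n)"
  using spreadable by (auto simp: spreadable_def)

lemma norm_iota: "norm (\<iota> n x) = norm x"
  using isometry by (simp add: cisometry_on_def)

lemma cadjoint_comp: "i < j \<Longrightarrow> cadjoint (\<iota> j) \<circ> \<iota> i = C"
proof -
  obtain D where D: "\<forall>i j. i < j \<longrightarrow> cadjoint (\<iota> j) \<circ> \<iota> i = D"
    using spreadable by (auto simp: spreadable_def)
  moreover have "C = D"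
    unfolding operator_angle_def
  proof (rule the_equality)
    show "E = D" if "\<forall>i j. i < j \<longrightarrow> cadjoint (\<iota> j) \<circ> \<iota> i = E" for E
      using D that by (metis zero_less_one)
  qed (rule D)
  ultimately show "i < j \<Longrightarrow> cadjoint (\<iota> j) \<circ> \<iota> i = C" by blast
qed

lemma gram_less: "i < j \<Longrightarrow> cinner (\<iota> j x) (\<iota> i y) = cinner x (C y)"
  using fun_cong[OF cadjoint_comp, of i j y] cadjoint_cisometry[OF isometry, of j x "\<iota> i y"] by simp

text \<open>\<open>C\<close> stays on the left, since its self-adjointness is derived only
  later.\<close>

lemma gram_greater: "i < j \<Longrightarrow> cinner (\<iota> i x) (\<iota> j y) = cinner (C x) y"
  by (subst (1 2) cinner_commute) (simp add: gram_less)

text \<open>The Gram matrix sees only the order of the indices. This invariance is what makes the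
  partial shifts of the sequence isometric.\<close>

lemma gram_strict_mono:
  assumes "strict_mono f"
  shows "cinner (\<iota> (f i) x) (\<iota> (f j) y) = cinner (\<iota> i x) (\<iota> j y)"
  by (cases i j rule: linorder_cases)
    (simp_all add: gram_less gram_greater strict_monoD[OF assms] cisometry_cinner[OF isometry])

section \<open>The limit space and its partial shifts\<close>

lemma sch_limit_closed_csubspace: "closed_csubspace (sch_limit \<iota>)"
  unfolding sch_limit_def by (rule closed_csubspace_closed_cspan)

lemma sch_limit_csubspace: "csubspace (sch_limit \<iota>)"
  using sch_limit_closed_csubspace by (simp add: closed_csubspace_def)

lemma range_sch_limit: "\<iota> n x \<in> sch_limit \<iota>"
  unfolding sch_limit_def by (rule subsetD[OF closed_cspan_superset]) auto

text \<open>Existence: the reindexing \<open>?s\<close> that skips \<open>n\<close> is strictly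
  increasing and so preserves the Gram matrix of all vectors \<open>\<iota> l x\<close>. Uniqueness:
  two such maps agree on a closed subspace containing these vectors, and extensionality settles the
  values outside.\<close>

lemma sch_map:
  "sch_map \<iota> n \<in> sch_limit \<iota> \<rightarrow>\<^sub>E sch_limit \<iota>"
  "cisometry_on (sch_limit \<iota>) (sch_map \<iota> n)"
  "sch_map \<iota> n (\<iota> l x) = (if l < n then \<iota> l x else \<iota> (Suc l) x)"
proof -
  let ?s = "\<lambda>l. if l < n then l else Suc l"
  define is_map where "is_map a \<longleftrightarrow>
     a \<in> sch_limit \<iota> \<rightarrow>\<^sub>E sch_limit \<iota> \<and> cisometry_on (sch_limit \<iota>) a \<and>
     (\<forall>l x. a (\<iota> l x) = (if l < n then \<iota> l x else \<iota> (Suc l) x))" for a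
  have u: "closed_cspan (range (\<lambda>(l, x). \<iota> l x)) = sch_limit \<iota>"
    unfolding sch_limit_def by (rule arg_cong[of _ _ closed_cspan]) force
  have v: "closed_cspan (range (\<lambda>(l, x). \<iota> (?s l) x)) \<subseteq> sch_limit \<iota>"
    using range_sch_limit by (intro closed_cspan_minimal sch_limit_closed_csubspace) auto
  have "strict_mono ?s" by (auto simp: strict_mono_def)
  then have "cinner ((\<lambda>(l, x). \<iota> l x) p) ((\<lambda>(l, x). \<iota> l x) q) =
      cinner ((\<lambda>(l, x). \<iota> (?s l) x) p) ((\<lambda>(l, x). \<iota> (?s l) x) q)" for p q
    using gram_strict_mono[of ?s] by (simp add: case_prod_unfold)
  then obtain T where T: "T \<in> sch_limit \<iota> \<rightarrow> closed_cspan (range (\<lambda>(l, x). \<iota> (?s l) x))"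
    "cisometry_on (sch_limit \<iota>) T" "\<And>p. T ((\<lambda>(l, x). \<iota> l x) p) = (\<lambda>(l, x). \<iota> (?s l) x) p"
    using gram_isometry[of "\<lambda>(l, x). \<iota> l x" "\<lambda>(l, x). \<iota> (?s l) x"] unfolding u by blast
  have "is_map (restrict T (sch_limit \<iota>))"
    unfolding is_map_def
  proof (intro conjI allI)
    show "restrict T (sch_limit \<iota>) \<in> sch_limit \<iota> \<rightarrow>\<^sub>E sch_limit \<iota>"
      using T(1) v by auto
    show "cisometry_on (sch_limit \<iota>) (restrict T (sch_limit \<iota>))"
      using T(2) sch_limit_csubspace
      by (auto simp: cisometry_on_def complex_vector.subspace_add complex_vector.subspace_scale)
    show "restrict T (sch_limit \<iota>) (\<iota> l x) = (if l < n then \<iota> l x else \<iota> (Suc l) x)" for l x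
      using T(3)[of "(l, x)"] range_sch_limit by auto
  qed
  moreover have "a = b" if a: "is_map a" and b: "is_map b" for a b
  proof (rule PiE_ext)
    show "a \<in> sch_limit \<iota> \<rightarrow>\<^sub>E sch_limit \<iota>" "b \<in> sch_limit \<iota> \<rightarrow>\<^sub>E sch_limit \<iota>"
      using a b by (auto simp: is_map_def)
    have "closed_csubspace {x \<in> sch_limit \<iota>. a x = b x}"
      using a b by (intro closed_csubspace_equalizer sch_limit_closed_csubspace) (auto simp: is_map_def)
    moreover have "(\<Union>l. range (\<iota> l)) \<subseteq> {x \<in> sch_limit \<iota>. a x = b x}"
      using a b range_sch_limit by (auto simp: is_map_def)
    ultimately have "sch_limit \<iota> \<subseteq> {x \<in> sch_limit \<iota>. a x = b x}"
      unfolding sch_limit_def[of \<iota>] by (intro closed_cspan_minimal) (auto simp: sch_limit_def)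
    then show "a x = b x" if "x \<in> sch_limit \<iota>" for x using that by blast
  qed
  ultimately have "\<exists>!a. is_map a" by blast
  then have "is_map (THE a. is_map a)" by (rule theI')
  moreover have "(THE a. is_map a) = sch_map \<iota> n"
    unfolding is_map_def sch_map_def ..
  ultimately have "is_map (sch_map \<iota> n)" by simp
  then show "sch_map \<iota> n \<in> sch_limit \<iota> \<rightarrow>\<^sub>E sch_limit \<iota>"
    "cisometry_on (sch_limit \<iota>) (sch_map \<iota> n)"
    "sch_map \<iota> n (\<iota> l x) = (if l < n then \<iota> l x else \<iota> (Suc l) x)"
    by (auto simp: is_map_def)
qed

lemma sch_fixed_closed_csubspace: "closed_csubspace (sch_fixed \<iota> n)"
  unfolding sch_fixed_def
  by (intro closed_csubspace_equalizer sch_limit_closed_csubspace sch_map)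
    (simp add: cisometry_on_def)

section \<open>Averages of the sequence and their limit\<close>

lemma inner_iota_iota:
  "inner (\<iota> i x) (\<iota> j x) = inner x (C x) + (if i = j then (norm x)\<^sup>2 - inner x (C x) else 0)"
  by (cases i j rule: linorder_cases)
    (simp_all add: Re_cinner[symmetric] gram_less gram_greater cisometry_cinner[OF isometry]
      cinner_self norm_iota cinner_commute[of "C x" x])

definition average :: "nat \<Rightarrow> 'k \<Rightarrow> 'h" where
  "average N x = (\<Sum>k<N. \<iota> k x) /\<^sub>R real N"

text \<open>This vector turns out to be the projection of \<open>\<iota> n x\<close> onto the fixed
  space of the shift, for every \<open>n\<close>.\<close>

definition mean :: "'k \<Rightarrow> 'h" where
  "mean x = lim (\<lambda>N. average N x)"

text \<open>Every pair of indices contributes \<open>inner x (C x)\<close>; the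
  \<open>min N M\<close> diagonal pairs contribute the excess as well.\<close>

lemma inner_average:
  assumes "N > 0" "M > 0"
  shows "inner (average N x) (average M x) =
    inner x (C x) + ((norm x)\<^sup>2 - inner x (C x)) * (real (min N M) / (real N * real M))"
proof -
  define c d where "c = inner x (C x)" and "d = (norm x)\<^sup>2 - c"
  have "inner (\<Sum>k<N. \<iota> k x) (\<Sum>k<M. \<iota> k x) = (\<Sum>i<N. \<Sum>j<M. c + (if i = j then d else 0))"
    unfolding inner_sum_left inner_sum_right inner_iota_iota c_def[symmetric] d_def[symmetric]
    by (rule sum.swap)
  also have "\<dots> = (\<Sum>i<N. real M * c + (if i \<in> {..<M} then d else 0))"
    by (simp add: sum.distrib)
  also have "\<dots> = real N * real M * c + real (card ({..<N} \<inter> {..<M})) * d"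
    by (simp only: sum.distrib sum.inter_restrict[symmetric] finite_lessThan) simp
  also have "{..<N} \<inter> {..<M} = {..<min N M}" by auto
  finally show ?thesis
    using assms unfolding average_def c_def[symmetric] d_def[symmetric]
    by (simp add: field_simps)
qed

lemma norm_average_diff:
  assumes "N > 0" "M > 0"
  shows "(norm (average N x - average M x))\<^sup>2 \<le>
    ((norm x)\<^sup>2 - inner x (C x)) * (1 / real N + 1 / real M)"
proof -
  define c d where "c = inner x (C x)" and "d = (norm x)\<^sup>2 - c"
  \<comment> \<open>Cauchy-Schwarz for two vectors of the sequence with distinct indices gives
    \<open>c\<close> at most the squared norm of \<open>x\<close>.\<close>
  have "inner (\<iota> 0 x) (\<iota> 1 x) \<le> norm (\<iota> 0 x) * norm (\<iota> 1 x)"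
    by (rule norm_cauchy_schwarz)
  then have d: "d \<ge> 0"
    by (simp add: inner_iota_iota c_def d_def norm_iota power2_eq_square)
  have "(norm (average N x - average M x))\<^sup>2 =
      d * (1 / real N + 1 / real M) - 2 * d * (real (min N M) / (real N * real M))"
    using assms unfolding power2_norm_eq_inner inner_diff_left inner_diff_right
    by (simp add: inner_average c_def[symmetric] d_def[symmetric] min.commute algebra_simps)
  also have "\<dots> \<le> d * (1 / real N + 1 / real M)"
    using d by simp
  finally show ?thesis by (simp add: c_def d_def)
qed

lemma tendsto_average: "(\<lambda>N. average N x) \<longlonglongrightarrow> mean x"
proof -
  define d where "d = (norm x)\<^sup>2 - inner x (C x)"
  have "Cauchy (\<lambda>N. average N x)"
  proof (rule metric_CauchyI)
    fix e :: real assume e: "e > 0"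
    have "(\<lambda>N. d * inverse (real N)) \<longlonglongrightarrow> d * 0"
      by (intro tendsto_intros lim_inverse_n)
    then have "\<forall>\<^sub>F N in sequentially. d * inverse (real N) < e\<^sup>2 / 2"
      using e by (intro order_tendstoD(2)) auto
    then obtain K where K: "\<And>N. N \<ge> K \<Longrightarrow> d * (1 / real N) < e\<^sup>2 / 2"
      by (auto simp: eventually_sequentially inverse_eq_divide)
    have "dist (average N x) (average M x) < e" if "N \<ge> Suc K" "M \<ge> Suc K" for N M
    proof -
      have "(norm (average N x - average M x))\<^sup>2 \<le> d * (1 / real N) + d * (1 / real M)"
        using norm_average_diff[of N M x] that by (simp add: d_def distrib_left)
      also have "\<dots> < e\<^sup>2"
        using K[of N] K[of M] that by linarith
      finally show ?thesis
        using e by (simp add: dist_norm power2_less_imp_less)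
    qed
    then show "\<exists>K. \<forall>N\<ge>K. \<forall>M\<ge>K. dist (average N x) (average M x) < e" by blast
  qed
  then show ?thesis
    unfolding mean_def by (simp add: Cauchy_convergent_iff convergent_LIMSEQ_iff)
qed

lemma cinner_average: "cinner z (average N x) = (\<Sum>k<N. cinner z (\<iota> k x)) /\<^sub>R real N"
  unfolding average_def
  by (simp add: cinner_scaleR_right
      linear_sum[OF bounded_linear.linear[OF bounded_linear_cinner_right]])

lemma cinner_mean:
  assumes "\<And>k. k \<ge> K \<Longrightarrow> cinner z (\<iota> k x) = c"
  shows "cinner z (mean x) = c"
proof (rule LIMSEQ_unique)
  show "(\<lambda>N. cinner z (average N x)) \<longlonglongrightarrow> cinner z (mean x)"
    by (intro tendsto_cinner tendsto_const tendsto_average)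
  show "(\<lambda>N. cinner z (average N x)) \<longlonglongrightarrow> c"
    unfolding cinner_average using assms by (rule tendsto_average_eventually_const)
qed

text \<open>Beyond the index \<open>m\<close> the averaged inner products are constant; the diagonal
  term and the earlier ones vanish in the limit.\<close>

lemma cinner_iota_mean: "cinner (\<iota> m y) (mean x) = cinner (C y) x"
  by (rule cinner_mean[of "Suc m"]) (simp add: gram_greater)

lemma sch_limit_subspace: "subspace (sch_limit \<iota>)"
  by (intro csubspace_imp_subspace sch_limit_csubspace)

lemma sch_map_average:
  "average N x \<in> sch_limit \<iota>"
  "sch_map \<iota> 0 (average N x) = (\<Sum>k<N. \<iota> (Suc k) x) /\<^sub>R real N"
proof -
  note iso = sch_map(2)[of 0, unfolded cisometry_on_def]
  have sum: "(\<Sum>k<N. \<iota> k x) \<in> sch_limit \<iota>" for N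
    by (intro subspace_sum sch_limit_subspace range_sch_limit)
  then show "average N x \<in> sch_limit \<iota>"
    unfolding average_def by (intro subspace_scale sch_limit_subspace)
  have "sch_map \<iota> 0 0 = 0"
    using iso subspace_0[OF sch_limit_subspace] by (metis norm_eq_zero)
  then have "sch_map \<iota> 0 (\<Sum>k<N. \<iota> k x) = (\<Sum>k<N. \<iota> (Suc k) x)" for N
    using iso sum range_sch_limit by (induction N) (auto simp: sch_map(3))
  moreover have "sch_map \<iota> 0 (r *\<^sub>R z) = r *\<^sub>R sch_map \<iota> 0 z" if "z \<in> sch_limit \<iota>" for r z
    using iso that scaleC_of_real by metis
  ultimately show "sch_map \<iota> 0 (average N x) = (\<Sum>k<N. \<iota> (Suc k) x) /\<^sub>R real N"
    unfolding average_def using sum by simp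
qed

text \<open>Shifting an average changes only its two end terms, an error of norm at most
  \<open>2 * norm x / N\<close>. The shift is isometric, so it passes to the limit.\<close>

lemma mean_fixed: "mean x \<in> sch_fixed \<iota> 0"
proof -
  have mem: "mean x \<in> sch_limit \<iota>"
    using sch_limit_closed_csubspace sch_map_average(1) tendsto_average
    unfolding closed_csubspace_def closed_sequential_limits by fast
  have "norm (sch_map \<iota> 0 (average N x) - sch_map \<iota> 0 (mean x)) = norm (average N x - mean x)" for N
    by (intro cisometry_on_norm_diff[OF sch_limit_csubspace] sch_map sch_map_average mem)
  then have 1: "(\<lambda>N. sch_map \<iota> 0 (average N x)) \<longlonglongrightarrow> sch_map \<iota> 0 (mean x)"
    using tendsto_average[of x] by (simp add: tendsto_iff dist_norm)
  have "sch_map \<iota> 0 (average N x) - average N x = (\<iota> N x - \<iota> 0 x) /\<^sub>R real N" for N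
    unfolding sch_map_average(2)
    unfolding average_def scaleR_diff_right[symmetric] sum_subtractf[symmetric]
    using sum_lessThan_telescope[of "\<lambda>k. \<iota> k x" N] by simp
  then have shift: "norm (sch_map \<iota> 0 (average N x) - average N x) =
      norm (\<iota> N x - \<iota> 0 x) * inverse (real N)" for N
    by simp
  have le: "norm (sch_map \<iota> 0 (average N x) - average N x) \<le> 2 * norm x * inverse (real N)" for N
    unfolding shift using norm_triangle_ineq4[of "\<iota> N x" "\<iota> 0 x"]
    by (intro mult_right_mono) (simp_all add: norm_iota)
  have "(\<lambda>N. 2 * norm x * inverse (real N)) \<longlonglongrightarrow> 0"
    by (intro tendsto_mult_right_zero lim_inverse_n)
  then have "(\<lambda>N. sch_map \<iota> 0 (average N x) - average N x) \<longlonglongrightarrow> 0"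
    by (rule Lim_null_comparison[OF always_eventually[OF allI[OF le]]])
  then have "(\<lambda>N. sch_map \<iota> 0 (average N x)) \<longlonglongrightarrow> mean x"
    by (rule Lim_transform[OF tendsto_average])
  then have "sch_map \<iota> 0 (mean x) = mean x"
    by (rule LIMSEQ_unique[OF 1])
  then show ?thesis
    using mem by (simp add: sch_fixed_def)
qed

section \<open>The mean as the projection onto the fixed space\<close>

lemma cinner_fixed_shift:
  assumes z: "z \<in> sch_fixed \<iota> 0"
  shows "cinner z (\<iota> n x) = cinner z (\<iota> 0 x)"
proof (induction n)
  case (Suc n)
  \<comment> \<open>The shift fixes \<open>z\<close> and carries \<open>\<iota> n x\<close> to the
    next vector, while preserving inner products.\<close>
  have "cinner z (\<iota> (Suc n) x) = cinner (sch_map \<iota> 0 z) (sch_map \<iota> 0 (\<iota> n x))"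
    using z by (simp add: sch_map sch_fixed_def)
  also have "\<dots> = cinner z (\<iota> n x)"
    using z by (intro cisometry_on_cinner[OF sch_limit_csubspace] sch_map range_sch_limit)
      (simp add: sch_fixed_def)
  finally show ?case using Suc by simp
qed simp

lemma cinner_fixed_mean:
  assumes "z \<in> sch_fixed \<iota> 0"
  shows "cinner z (mean x) = cinner z (\<iota> n x)"
  by (rule cinner_mean) (metis cinner_fixed_shift[OF assms])

lemma sch_fixed_csubspace: "csubspace (sch_fixed \<iota> n)"
  using sch_fixed_closed_csubspace by (simp add: closed_csubspace_def)

text \<open>A fixed vector has the same inner product with all \<open>\<iota> k x\<close>, hence
  with their averages and the limit; so \<open>\<iota> n x - mean x\<close> is orthogonal to the
  fixed space.\<close>

lemma orth_proj_iota: "orth_proj (sch_fixed \<iota> 0) (\<iota> n x) = mean x"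
  by (intro orth_proj_eqI sch_fixed_csubspace mean_fixed)
    (simp add: cinner_diff_right cinner_fixed_mean[of _ x n])

lemma cinner_mean_iota: "cinner (mean y) (\<iota> n x) = cinner (mean y) (mean x)"
  by (rule cinner_fixed_mean[OF mean_fixed, symmetric])

text \<open>As \<open>mean x\<close> is fixed, \<open>mean y\<close> may be replaced by
  \<open>\<iota> 0 y\<close>, whose inner product with \<open>mean x\<close> is known.\<close>

lemma cinner_mean_mean: "cinner (mean y) (mean x) = cinner (C y) x"
  using cinner_mean_iota[of x 0 y] cinner_iota_mean[of 0 y x]
  by (metis cinner_commute)

section \<open>Properties of the operator angle\<close>

lemma angle_selfadjoint: "cinner (C y) x = cinner y (C x)"
  using cinner_mean_mean[of y x] cinner_mean_mean[of x y]
  by (metis cinner_commute)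

text \<open>All four terms of the expanded product equal \<open>cinner (C y) x\<close>, and their
  signs cancel.\<close>

lemma orthogonal_complements:
  assumes "m \<noteq> n"
  shows "cinner (\<iota> m y - mean y) (\<iota> n x - mean x) = 0"
proof -
  have "cinner (\<iota> m y) (\<iota> n x) = cinner (C y) x"
    using assms by (cases m n rule: linorder_cases)
      (simp_all add: gram_less gram_greater angle_selfadjoint)
  then show ?thesis
    by (simp add: cinner_diff_left cinner_diff_right cinner_iota_mean cinner_mean_iota cinner_mean_mean)
qed

text \<open>The value is the same for every \<open>n\<close>, which yields both formulas for the
  angle, with adjoints of \<open>\<iota> 0\<close> and of \<open>\<iota> 1\<close>.\<close>

lemma cadjoint_mean: "cadjoint (\<iota> n) (mean x) = C x"
  by (intro cadjoint_cisometry_eqI isometry) (simp add: cinner_iota_mean angle_selfadjoint)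

lemma bounded_clinear_angle: "bounded_clinear C"
proof -
  have scale: "C (c *\<^sub>C x) = c *\<^sub>C C x" for c x
    by (rule cinner_ext) (simp add: angle_selfadjoint[symmetric] cinner_scaleC_right)
  moreover have "bounded_linear C"
  proof (rule bounded_linear_intro[of _ 1])
    show "C (x + y) = C x + C y" for x y
      by (rule cinner_ext) (simp add: angle_selfadjoint[symmetric] cinner_add_right)
    show "C (r *\<^sub>R x) = r *\<^sub>R C x" for r x
      using scale[of "complex_of_real r" x] by (simp add: scaleC_of_real)
    show "norm (C x) \<le> norm x * 1" for x
    proof -
      \<comment> \<open>Testing the Gram identity at \<open>C x\<close> itself turns the inner
        product into the squared norm, so Cauchy-Schwarz bounds \<open>C\<close>.\<close>
      have "norm (C x) * norm (C x) = norm (cinner (\<iota> 1 (C x)) (\<iota> 0 x))"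
        by (simp add: gram_less cinner_self norm_power power2_eq_square norm_mult)
      also have "\<dots> \<le> norm (C x) * norm x"
        using norm_cinner_le[of "\<iota> 1 (C x)" "\<iota> 0 x"] by (simp add: norm_iota)
      finally show ?thesis
        using norm_ge_zero[of x] by (cases "C x = 0") simp_all
    qed
  qed
  ultimately show ?thesis by (simp add: bounded_clinear_def)
qed

text \<open>The quadratic form of \<open>C\<close> is the squared norm of
  \<open>mean x\<close>.\<close>

lemma angle_nonneg: "op_le (\<lambda>_. 0) C"
proof -
  have "cinner x (C x) = complex_of_real ((norm (mean x))\<^sup>2)" for x
    by (simp only: angle_selfadjoint[symmetric] cinner_mean_mean[symmetric] cinner_self)
  then show ?thesis
    using bounded_clinear_angle
    by (simp add: op_le_def positive_op_def)
      (simp add: bounded_clinear_def)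
qed

text \<open>The fixed space then lies in the range of \<open>\<iota> 0\<close>, so
  \<open>mean x\<close> is \<open>\<iota> 0 (C x)\<close>. Pulled back along
  \<open>\<iota> 0\<close>, the projection onto the fixed space becomes \<open>C\<close>, with range
  \<open>?V\<close>.\<close>

lemma angle_projection:
  assumes "sch_fixed \<iota> 0 \<subseteq> sch_space \<iota> 0"
  shows "is_orth_proj C"
proof -
  let ?V = "\<iota> 0 -` sch_fixed \<iota> 0"
  have "sch_space \<iota> 0 \<subseteq> range (\<iota> 0)"
    unfolding sch_space_def
    using complete_range_cisometry[OF isometry] csubspace_range_cisometry[OF isometry]
    by (intro closed_cspan_minimal) (auto simp: closed_csubspace_def intro: complete_imp_closed)
  then have range: "sch_fixed \<iota> 0 \<subseteq> range (\<iota> 0)" using assms by blast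
  have add: "\<iota> 0 (x + y) = \<iota> 0 x + \<iota> 0 y" "\<iota> 0 (c *\<^sub>C x) = c *\<^sub>C \<iota> 0 x" for x y c
    using isometry[of 0] by (simp_all add: cisometry_on_def)
  have V: "csubspace ?V"
    using sch_fixed_csubspace[of 0] add linear_simps(3)[OF bounded_linear_cisometry[OF isometry]]
    by (simp add: complex_vector.subspace_def)
  have "closed ?V"
    using sch_fixed_closed_csubspace[of 0]
    by (intro closed_vimage linear_continuous_on bounded_linear_cisometry isometry)
      (simp add: closed_csubspace_def)
  moreover have "orth_proj ?V x = C x" for x
  proof (rule orth_proj_eqI[OF V])
    obtain v where v: "mean x = \<iota> 0 v"
      using range mean_fixed by blast
    \<comment> \<open>The adjoint of \<open>\<iota> 0\<close> is a left inverse of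
      \<open>\<iota> 0\<close>, and it sends \<open>mean x\<close> to \<open>C x\<close>.\<close>
    have "C x = v"
      unfolding cadjoint_mean[of 0, symmetric] v
      by (intro cadjoint_cisometry_eqI isometry cisometry_cinner)
    then have Cx: "\<iota> 0 (C x) = mean x" using v by simp
    then show "C x \<in> ?V" using mean_fixed by simp
    fix z assume "z \<in> ?V"
    then have "cinner (\<iota> 0 z) (\<iota> 0 x) = cinner (\<iota> 0 z) (\<iota> 0 (C x))"
      using cinner_fixed_mean[of "\<iota> 0 z" x 0] by (simp add: Cx)
    then show "cinner z (x - C x) = 0"
      by (simp add: cisometry_cinner[OF isometry] cinner_diff_right)
  qed
  ultimately show ?thesis
    using V unfolding is_orth_proj_def closed_csubspace_def by (metis ext)
qed

end

section \<open>Realizing positive contractions\<close>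

text \<open>The defect \<open>g\<close> is sesquilinear and vanishes on the diagonal; evaluating it
  at \<open>x + y\<close> and at \<open>x + \<i> *\<^sub>C y\<close> makes it vanish
  everywhere.\<close>

lemma selfadjoint_if_real_form:
  fixes A :: "'a::complex_inner \<Rightarrow> 'a"
  assumes A: "bounded_clinear A" and real: "\<And>x. cinner x (A x) \<in> \<real>"
  shows "cinner x (A y) = cinner (A x) y"
proof -
  have add: "A (x + y) = A x + A y" and scale: "A (c *\<^sub>C x) = c *\<^sub>C A x" for x y c
    using A by (auto simp: bounded_clinear_def linear_simps)
  define g where "g x y = cinner x (A y) - cinner (A x) y" for x y
  have g0: "g x x = 0" for x
    using real[of x] cinner_commute[of "A x" x] by (simp add: g_def Reals_cnj_iff)
  have "g (x + y) (x + y) = g x x + g x y + (g y x + g y y)"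
    by (simp add: g_def add cinner_add_left cinner_add_right)
  moreover have "g (x + \<i> *\<^sub>C y) (x + \<i> *\<^sub>C y) = g x x + \<i> * g x y + (- \<i> * g y x + g y y)"
    by (simp add: g_def add scale cinner_add_left cinner_add_right cinner_scaleC_left
        cinner_scaleC_right algebra_simps)
  ultimately have "g x y + g y x = 0" "\<i> * g x y - \<i> * g y x = 0"
    by (simp_all add: g0)
  then have "g x y = 0" by (simp add: eq_neg_iff_add_eq_0[symmetric])
  then show ?thesis by (simp add: g_def)
qed

text \<open>The operator interval from zero to the identity, phrased algebraically so that it passes
  easily to \<open>1 - A\<close> and to \<open>A\<close> minus its square. Self-adjointness is
  recorded because the computations move operators across inner products.\<close>

definition effect :: "('a::complex_inner \<Rightarrow> 'a) \<Rightarrow> bool" where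
  "effect A \<longleftrightarrow> (\<forall>x y. A (x + y) = A x + A y) \<and> (\<forall>c x. A (c *\<^sub>C x) = c *\<^sub>C A x) \<and>
     (\<forall>x y. cinner x (A y) = cinner (A x) y) \<and>
     (\<forall>x. 0 \<le> inner x (A x) \<and> inner x (A x) \<le> inner x x)"

lemma effect_diff_eq: "effect A \<Longrightarrow> A (x - y) = A x - A y"
  unfolding effect_def by (metis add_diff_cancel_right' diff_add_cancel)

lemma effect_if_op_le:
  fixes A :: "'a::complex_inner \<Rightarrow> 'a"
  assumes "op_le (\<lambda>_. 0) A" "op_le A id"
  shows "effect A"
proof -
  have A: "bounded_clinear A" and pos: "cinner x (A x) \<in> \<real>\<^sub>\<ge>\<^sub>0" and le: "cinner x (x - A x) \<in> \<real>\<^sub>\<ge>\<^sub>0" for x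
    using assms by (auto simp: op_le_def positive_op_def)
  have "0 \<le> inner x (A x) \<and> inner x (A x) \<le> inner x x" for x
    using pos[of x] le[of x] by (simp add: complex_nonneg_Reals_iff Re_cinner inner_diff_right)
  moreover have "cinner x (A y) = cinner (A x) y" for x y
    by (rule selfadjoint_if_real_form[OF A]) (use pos nonneg_Reals_subset_Reals in blast)
  ultimately show ?thesis
    using A by (simp add: effect_def bounded_clinear_def linear_simps)
qed

lemma effect_complement:
  assumes "effect A"
  shows "effect (\<lambda>x. x - A x)"
  using assms by (auto simp: effect_def cinner_diff_left cinner_diff_right inner_diff_right
      scaleC_add_right complex_vector.scale_right_diff_distrib)

text \<open>Positivity of \<open>A - A\<^sup>2\<close> comes from \<open>A - A\<^sup>2 = A (1 - A) A + (1 - A) A (1 - A)\<close>.\<close>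

lemma effect_minus_square:
  assumes A: "effect A"
  shows "effect (\<lambda>x. A x - A (A x))"
proof -
  have sa: "cinner x (A y) = cinner (A x) y" for x y
    using A by (simp add: effect_def)
  have isa: "inner x (A y) = inner (A x) y" for x y
    using sa[of x y] by (simp add: Re_cinner[symmetric])
  have pos: "0 \<le> inner x (A x)" "inner x (A x) \<le> inner x x" for x
    using A by (auto simp: effect_def)
  have "0 \<le> inner x (A x - A (A x)) \<and> inner x (A x - A (A x)) \<le> inner x x" for x
  proof
    have "inner (x - A x) (A (x - A x)) = inner x (A x) - 2 * inner (A x) (A x) + inner (A x) (A (A x))"
      by (simp add: effect_diff_eq[OF A] inner_diff_left inner_diff_right isa)
    then show "0 \<le> inner x (A x - A (A x))"
      using pos(1)[of "x - A x"] pos(2)[of "A x"] by (simp add: inner_diff_right isa)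
    show "inner x (A x - A (A x)) \<le> inner x x"
      using pos(2)[of x] inner_ge_zero[of "A x"]
      unfolding inner_diff_right isa[of x "A x"] by linarith
  qed
  then show ?thesis
    using A unfolding effect_def
    by (auto simp: cinner_diff_left cinner_diff_right complex_vector.scale_right_diff_distrib)
qed

section \<open>Factorization of an effect by telescoping squares\<close>

primrec residual :: "('a::complex_inner \<Rightarrow> 'a) \<Rightarrow> nat \<Rightarrow> 'a \<Rightarrow> 'a" where
  "residual A 0 = A"
| "residual A (Suc n) = (\<lambda>x. residual A n x - residual A n (residual A n x))"

lemma effect_residual: "effect A \<Longrightarrow> effect (residual A n)"
  by (induction n) (simp_all add: effect_minus_square)

lemma cinner_residual:
  assumes "effect A"
  shows "cinner (residual A n x) (residual A n y) =
    cinner x (residual A n y) - cinner x (residual A (Suc n) y)"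
  using effect_residual[OF assms, of n] by (simp add: effect_def cinner_diff_right)

text \<open>The partial sums telescope to \<open>inner x (A x)\<close> minus the form of the current
  residual, which is nonnegative because residuals are effects.\<close>

lemma summable_residual:
  assumes A: "effect A"
  shows "summable (\<lambda>n. (norm (residual A n x))\<^sup>2)"
proof (rule summableI_nonneg_bounded)
  have "(norm (residual A n x))\<^sup>2 = inner x (residual A n x) - inner x (residual A (Suc n) x)" for n
    using arg_cong[OF cinner_residual[OF A, of n x x], of Re]
    by (simp add: Re_cinner power2_norm_eq_inner)
  then have "(\<Sum>k<n. (norm (residual A k x))\<^sup>2) = inner x (A x) - inner x (residual A n x)" for n
    by (induction n) simp_all
  then show "(\<Sum>k<n. (norm (residual A k x))\<^sup>2) \<le> inner x (A x)" for n
    using effect_residual[OF A, of n] by (simp add: effect_def)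
qed simp

lemma tendsto_residual:
  assumes "effect A"
  shows "(\<lambda>n. residual A n x) \<longlonglongrightarrow> 0"
proof -
  have "(\<lambda>n. sqrt ((norm (residual A n x))\<^sup>2)) \<longlonglongrightarrow> sqrt 0"
    by (intro tendsto_real_sqrt summable_LIMSEQ_zero summable_residual assms)
  then show ?thesis by (simp add: tendsto_norm_zero_iff)
qed

text \<open>The partial sums of \<open>\<Sum>n. (residual A n)\<^sup>2\<close> telescope to \<open>A - residual A n\<close>, so \<open>factor A\<close>
  satisfies \<open>(factor A)\<^sup>* (factor A) = A\<close> and stands in for a square root of \<open>A\<close>.\<close>

definition factor :: "('a::complex_inner \<Rightarrow> 'a) \<Rightarrow> 'a \<Rightarrow> 'a ell2" where
  "factor A x = Abs_ell2 (\<lambda>n. residual A n x)"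

lemma factor_nth: "effect A \<Longrightarrow> ell2_nth (factor A x) n = residual A n x"
  by (simp add: factor_def Abs_ell2_inverse summable_residual)

lemma factor_add: "effect A \<Longrightarrow> factor A (x + y) = factor A x + factor A y"
  by (rule ell2_eqI, use effect_residual[of A] in
      \<open>simp add: factor_nth ell2_nth_simps effect_def\<close>)

lemma factor_scaleC: "effect A \<Longrightarrow> factor A (c *\<^sub>C x) = c *\<^sub>C factor A x"
  by (rule ell2_eqI, use effect_residual[of A] in
      \<open>simp add: factor_nth scaleC_ell2.rep_eq effect_def\<close>)

lemma cinner_factor:
  assumes A: "effect A"
  shows "cinner (factor A x) (factor A y) = cinner x (A y)"
proof -
  have "(\<lambda>n. cinner x (residual A n y)) \<longlonglongrightarrow> cinner x 0"
    by (intro tendsto_cinner tendsto_const tendsto_residual A)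
  from telescope_sums'[OF this] show ?thesis
    by (simp add: cinner_ell2_def factor_nth[OF A] cinner_residual[OF A] cinner_zero_right sums_iff
        del: residual.simps(2))
qed

section \<open>Disjoint blocks of coordinates\<close>

lemma sums_prod_decode_block:
  fixes h :: "nat \<Rightarrow> 'a::{t2_space,comm_monoid_add}"
  shows "(\<lambda>p. if fst (prod_decode p) = a then h (snd (prod_decode p)) else 0) sums c \<longleftrightarrow> h sums c"
proof -
  \<comment> \<open>Each block is enumerated in increasing order, so only zeros are inserted between
    the terms of \<open>h\<close> and their order is kept.\<close>
  have "strict_mono (\<lambda>b. prod_encode (a, b))"
    unfolding strict_mono_Suc_iff by (simp add: prod_encode_def)
  moreover have "fst (prod_decode p) \<noteq> a" if "p \<notin> range (\<lambda>b. prod_encode (a, b))" for p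
    using that by (metis prod.collapse prod_decode_inverse rangeI)
  ultimately show ?thesis
    using sums_mono_reindex[of "\<lambda>b. prod_encode (a, b)"
        "\<lambda>p. if fst (prod_decode p) = a then h (snd (prod_decode p)) else 0" c]
    by simp
qed

text \<open>The pairing of natural numbers provides countably many mutually orthogonal copies of
  \<open>ell2\<close> inside the same type.\<close>

lift_definition ell2_block :: "nat \<Rightarrow> 'a::complex_inner ell2 \<Rightarrow> 'a ell2" is
  "\<lambda>a f p. if fst (prod_decode p) = a then f (snd (prod_decode p)) else 0"
proof -
  fix a and f :: "nat \<Rightarrow> 'a"
  assume "summable (\<lambda>n. (norm (f n))\<^sup>2)"
  then have "summable (\<lambda>p. if fst (prod_decode p) = a then (norm (f (snd (prod_decode p))))\<^sup>2 else 0)"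
    unfolding summable_def sums_prod_decode_block[of a "\<lambda>n. (norm (f n))\<^sup>2"] .
  then show "summable (\<lambda>p. (norm (if fst (prod_decode p) = a then f (snd (prod_decode p)) else 0))\<^sup>2)"
    by (rule back_subst[of summable]) auto
qed

lemma ell2_block_add: "ell2_block a (f + g) = ell2_block a f + ell2_block a g"
  by (rule ell2_eqI) (simp add: ell2_block.rep_eq ell2_nth_simps)

lemma ell2_block_scaleC: "ell2_block a (c *\<^sub>C f) = c *\<^sub>C ell2_block a f"
  by (rule ell2_eqI) (simp add: ell2_block.rep_eq scaleC_ell2.rep_eq)

lemma cinner_ell2_block:
  "cinner (ell2_block a f) (ell2_block b g) = (if a = b then cinner f g else 0)"
proof (cases "a = b")
  case True
  have "(\<lambda>n. cinner (ell2_nth f n) (ell2_nth g n)) sums cinner f g"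
    unfolding cinner_ell2_def using summable_ell2_cinner by (rule summable_sums)
  then have "(\<lambda>p. if fst (prod_decode p) = a
      then cinner (ell2_nth f (snd (prod_decode p))) (ell2_nth g (snd (prod_decode p))) else 0)
      sums cinner f g"
    unfolding sums_prod_decode_block[of a "\<lambda>n. cinner (ell2_nth f n) (ell2_nth g n)"] .
  moreover have "cinner (ell2_nth (ell2_block a f) p) (ell2_nth (ell2_block b g) p) =
      (if fst (prod_decode p) = a
       then cinner (ell2_nth f (snd (prod_decode p))) (ell2_nth g (snd (prod_decode p))) else 0)" for p
    using True by (simp add: ell2_block.rep_eq cinner_zero_right)
  ultimately show ?thesis
    unfolding cinner_ell2_def[of "ell2_block a f" "ell2_block b g"]
    using True by (simp add: sums_iff)
next
  case False
  have "cinner (ell2_nth (ell2_block a f) p) (ell2_nth (ell2_block b g) p) = 0" for p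
    using False cinner_commute[of 0 "ell2_nth g (snd (prod_decode p))"]
    by (simp add: ell2_block.rep_eq cinner_zero_right)
  then show ?thesis using False by (simp add: cinner_ell2_def)
qed

lemma spreadable_realization:
  fixes C :: "'k::chilbert_space \<Rightarrow> 'k"
  assumes C: "op_le (\<lambda>_. 0) C" "op_le C id"
  obtains \<iota> :: "nat \<Rightarrow> 'k \<Rightarrow> 'k ell2" where "spreadable \<iota>" "operator_angle \<iota> = C"
proof -
  have eff: "effect C" "effect (\<lambda>x. x - C x)"
    using effect_if_op_le[OF C] effect_complement by blast+
  \<comment> \<open>The shared block 0 contributes \<open>cinner x (C y)\<close> for all pairs of
    indices; the private block \<open>Suc n\<close>, which avoids 0, adds the complementary form on
    the diagonal only.\<close>
  define \<iota> where
    "\<iota> n x = ell2_block 0 (factor C x) + ell2_block (Suc n) (factor (\<lambda>x. x - C x) x)" for n x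
  have gram: "cinner (\<iota> i x) (\<iota> j y) = cinner x (C y) + (if i = j then cinner x (y - C y) else 0)"
    for i j x y
    by (simp add: \<iota>_def cinner_add_left cinner_add_right cinner_ell2_block cinner_factor eff)
  have iso: "cisometry (\<iota> n)" for n
    unfolding cisometry_on_def
  proof (intro conjI allI ballI)
    show "\<iota> n (x + y) = \<iota> n x + \<iota> n y" for x y
      by (simp add: \<iota>_def factor_add eff ell2_block_add)
    show "\<iota> n (c *\<^sub>C x) = c *\<^sub>C \<iota> n x" for c x
      by (simp add: \<iota>_def factor_scaleC eff ell2_block_scaleC scaleC_add_right)
    show "norm (\<iota> n x) = norm x" for x
      using gram[of n x n x] unfolding norm_eq_sqrt_inner Re_cinner[symmetric]
      by (simp add: cinner_diff_right)
  qed
  have "cadjoint (\<iota> j) \<circ> \<iota> i = C" if "i < j" for i j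
    using that by (intro ext) (simp add: cadjoint_cisometry_eqI iso gram)
  then have angle: "\<forall>i j. i < j \<longrightarrow> cadjoint (\<iota> j) \<circ> \<iota> i = C" by blast
  then have "spreadable \<iota>"
    unfolding spreadable_def using iso by blast
  moreover from this interpret spreadable_sequence \<iota> by unfold_locales
  have "operator_angle \<iota> = C"
    using cadjoint_comp[of 0 1] angle by simp
  ultimately show ?thesis using that by blast
qed

theorem theorem9p2:
  shows "(\<forall>(\<iota> :: nat \<Rightarrow> 'k::chilbert_space \<Rightarrow> 'h::chilbert_space) C Q.
            spreadable \<iota> \<longrightarrow> C = operator_angle \<iota> \<longrightarrow> Q = orth_proj (sch_fixed \<iota> 0) \<longrightarrow>
              (\<forall>m n. m \<noteq> n \<longrightarrow>
                 orthogonal_sets ((\<lambda>h. h - Q h) ` range (\<iota> m)) ((\<lambda>h. h - Q h) ` range (\<iota> n))) \<and>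
              C = cadjoint (\<iota> 1) \<circ> Q \<circ> \<iota> 0 \<and>
              C = cadjoint (\<iota> 0) \<circ> Q \<circ> \<iota> 0 \<and>
              op_le (\<lambda>_. 0) C \<and>
              (\<forall>A. sch_augmentation \<iota> A \<and> sch_saturated \<iota> A \<longrightarrow> is_orth_proj C)) \<and>
         (\<forall>C :: 'k \<Rightarrow> 'k. op_le (\<lambda>_. 0) C \<and> op_le C id \<longrightarrow>
            (\<exists>\<iota> :: nat \<Rightarrow> 'k \<Rightarrow> 'k ell2. spreadable \<iota> \<and> operator_angle \<iota> = C))"
proof (intro conjI allI impI)
  fix \<iota> :: "nat \<Rightarrow> 'k \<Rightarrow> 'h" and C Q
  assume "spreadable \<iota>" and C: "C = operator_angle \<iota>" and Q: "Q = orth_proj (sch_fixed \<iota> 0)"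
  then interpret spreadable_sequence \<iota> by unfold_locales
  show "orthogonal_sets ((\<lambda>h. h - Q h) ` range (\<iota> m)) ((\<lambda>h. h - Q h) ` range (\<iota> n))"
    if "m \<noteq> n" for m n
    using orthogonal_complements[OF that] by (auto simp: orthogonal_sets_def Q orth_proj_iota)
  show "C = cadjoint (\<iota> 1) \<circ> Q \<circ> \<iota> 0" "C = cadjoint (\<iota> 0) \<circ> Q \<circ> \<iota> 0"
    unfolding C by (simp_all add: fun_eq_iff Q orth_proj_iota cadjoint_mean)
  show "op_le (\<lambda>_. 0) C"
    unfolding C by (rule angle_nonneg)
  \<comment> \<open>Saturation identifies \<open>A\<close> with the fixed space, and being an
    augmentation places \<open>A\<close> inside \<open>sch_space \<iota> 0\<close>.\<close>
  show "is_orth_proj C" if "sch_augmentation \<iota> A \<and> sch_saturated \<iota> A" for A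
    unfolding C using that
    by (intro angle_projection) (auto simp: sch_augmentation_def sch_saturated_def)
next
  fix C :: "'k \<Rightarrow> 'k"
  assume "op_le (\<lambda>_. 0) C \<and> op_le C id"
  then show "\<exists>\<iota> :: nat \<Rightarrow> 'k \<Rightarrow> 'k ell2. spreadable \<iota> \<and> operator_angle \<iota> = C"
    using spreadable_realization by metis
qed

end
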